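(* Let $D$ be any connected link diagram in the plane $\mathbb{R}^2$. Then one can choose undirected smoothing operations at all the crossings of $D$ such that applying them to $D$ yields a monadic circles and arcs system.
   Context: A link diagram is connected if it is connected when the underpasses are restored at all the crossings, i.e. its underlying planar projection is a connected subset of $\mathbb{R}^2$. A circles and arcs system in $\mathbb{R}^2$ is a union $C\cup A$ where $C$ is a disjoint union of circles in $\mathbb{R}^2$ and $A$ is a disjoint union of arcs in $\mathbb{R}^2$ with $A\cap C=\partial A$, where $\partial A$ denotes the set of endpoints of the arcs of $A$. It is monadic if $C$ consists of only one circle. An undirected smoothing operation at a crossing replaces, in a small disk around the crossing, the two crossing strands by one of the two possible pairs of disjoint arcs joining the same four endpoints, regardless of orientation; in addition, as a substitute for the crossing, one places a line segment inside the disk connecting the two new arcs. Performing such operations at all crossings yields a circles and arcs system, whose arcs are the placed line segments. *)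

theory Defs
  imports "HOL-Analysis.Analysis"
begin

type_synonym plane = "real ^ 2"

subsection \<open>Link diagrams\<close>

text \<open>
  A diagram is a parametrised projection of finitely many circles, indexed by
  \<open>{..<num_comps}\<close>, together with over/under information: \<open>over D x\<close> is the preimage of the
  crossing \<open>x\<close> that lies on the overpass. The values of \<open>param\<close> off \<^term>\<open>{..<n} \<times> sphere 0 1\<close>
  and of \<open>over\<close> off the crossings are irrelevant.
\<close>

record diagram =
  num_comps :: nat
  param :: "nat \<times> complex \<Rightarrow> plane"
  over :: "plane \<Rightarrow> nat \<times> complex"

definition source :: "diagram \<Rightarrow> (nat \<times> complex) set" where
  "source D = {..<num_comps D} \<times> sphere 0 1"

definition projection :: "diagram \<Rightarrow> plane set" where
  "projection D = param D ` source D"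

definition preimages :: "diagram \<Rightarrow> plane \<Rightarrow> (nat \<times> complex) set" where
  "preimages D x = {p \<in> source D. param D p = x}"

definition crossings :: "diagram \<Rightarrow> plane set" where
  "crossings D = {x. card (preimages D x) = 2}"

text \<open>
  The model of a crossing is the closed unit disk with its two coordinate diameters.
  A crossing disk at \<open>x\<close> is a topologically embedded closed disk centred at \<open>x\<close> (an injective
  continuous map on a compact set is an embedding) that meets the projection exactly in the
  image of the two diameters. The last condition makes the crossing transverse: each of the two
  strands through \<open>x\<close> runs along one diameter. It excludes two strands that merely touch at \<open>x\<close>,
  each turning from one diameter into the other; those have the same image.
\<close>

definition strand :: "2 \<Rightarrow> plane set" where
  "strand i = closed_segment (- axis i 1) (axis i 1)"

definition crossing_disk :: "diagram \<Rightarrow> plane \<Rightarrow> (plane \<Rightarrow> plane) \<Rightarrow> bool" where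
  "crossing_disk D x h \<longleftrightarrow>
     continuous_on (cball 0 1) h \<and> inj_on h (cball 0 1) \<and> h 0 = x \<and>
     projection D \<inter> h ` cball 0 1 = h ` (strand 1 \<union> strand 2) \<and>
     (\<exists>p q. preimages D x = {p, q} \<and>
        (\<forall>\<^sub>F z in at p within source D. param D z \<in> h ` strand 1) \<and>
        (\<forall>\<^sub>F z in at q within source D. param D z \<in> h ` strand 2))"

text \<open>
  Diagrams are taken in the topological category, with transverse double points required to be
  locally standard; this covers both smooth and piecewise linear diagrams. A link has at least
  one component. Finiteness of \<^term>\<open>preimages D x\<close> is needed as infinite sets have cardinality 0.
\<close>

definition link_diagram :: "diagram \<Rightarrow> bool" where
  "link_diagram D \<longleftrightarrow>
     num_comps D \<ge> 1 \<and>
     continuous_on (source D) (param D) \<and>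
     (\<forall>x. finite (preimages D x) \<and> card (preimages D x) \<le> 2) \<and>
     finite (crossings D) \<and>
     (\<forall>x\<in>crossings D. (\<exists>h. crossing_disk D x h) \<and> over D x \<in> preimages D x)"

definition connected_diagram :: "diagram \<Rightarrow> bool" where
  "connected_diagram D \<longleftrightarrow> connected (projection D)"


subsection \<open>Circles and arcs systems\<close>

definition is_circle :: "plane set \<Rightarrow> bool" where
  "is_circle S \<longleftrightarrow> S homeomorphic sphere (0::complex) 1"

definition is_arc :: "plane set \<Rightarrow> bool" where
  "is_arc S \<longleftrightarrow> (\<exists>g. arc g \<and> path_image g = S)"

text \<open>Reversing a parametrisation shows that both endpoints of an arc are obtained.\<close>

definition arc_endpoints :: "plane set \<Rightarrow> plane set" where
  "arc_endpoints S = {pathstart g | g. arc g \<and> path_image g = S}"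

definition circles_arcs_system :: "plane set \<Rightarrow> plane set \<Rightarrow> bool" where
  "circles_arcs_system C A \<longleftrightarrow>
     (\<exists>\<C> \<A>. finite \<C> \<and> pairwise disjnt \<C> \<and> (\<forall>c\<in>\<C>. is_circle c) \<and> C = \<Union>\<C> \<and>
            finite \<A> \<and> pairwise disjnt \<A> \<and> (\<forall>a\<in>\<A>. is_arc a) \<and> A = \<Union>\<A> \<and>
            A \<inter> C = (\<Union>a\<in>\<A>. arc_endpoints a))"

definition monadic_system :: "plane set \<Rightarrow> plane set \<Rightarrow> bool" where
  "monadic_system C A \<longleftrightarrow> circles_arcs_system C A \<and> is_circle C"


subsection \<open>Undirected smoothing\<close>

definition smoothing_disks :: "diagram \<Rightarrow> (plane \<Rightarrow> plane \<Rightarrow> plane) \<Rightarrow> bool" where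
  "smoothing_disks D h \<longleftrightarrow>
     (\<forall>x\<in>crossings D. crossing_disk D x (h x)) \<and>
     pairwise (\<lambda>x y. disjnt (h x ` cball 0 1) (h y ` cball 0 1)) (crossings D)"

text \<open>
  In the model disk the two diameters have the four endpoints \<open>\<plusminus>axis 1 1\<close> and \<open>\<plusminus>axis 2 1\<close>.
  The two possible pairs of disjoint arcs joining them join \<open>axis 1 1\<close> either to \<open>axis 2 1\<close> or
  to \<open>-axis 2 1\<close>, and the remaining two endpoints to each other; arcs are drawn as chords. The
  connecting segment joins the midpoints of the two chords.
\<close>

definition smoothing_end :: "bool \<Rightarrow> plane" where
  "smoothing_end b = (if b then axis 2 1 else - axis 2 1)"

definition new_arcs :: "bool \<Rightarrow> plane set" where
  "new_arcs b = closed_segment (axis 1 1) (smoothing_end b) \<union>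
                closed_segment (- axis 1 1) (- smoothing_end b)"

definition connecting_segment :: "bool \<Rightarrow> plane set" where
  "connecting_segment b =
     closed_segment (midpoint (axis 1 1) (smoothing_end b))
                    (midpoint (- axis 1 1) (- smoothing_end b))"

text \<open>
  The smoothing is transported to the plane by the disks \<open>h x\<close>; \<open>\<sigma> x\<close> selects the smoothing at
  the crossing \<open>x\<close>. The results are the part \<open>C\<close> and the part \<open>A\<close> of the system obtained.
\<close>

definition smoothed_curves ::
    "diagram \<Rightarrow> (plane \<Rightarrow> plane \<Rightarrow> plane) \<Rightarrow> (plane \<Rightarrow> bool) \<Rightarrow> plane set" where
  "smoothed_curves D h \<sigma> =
     (projection D - (\<Union>x\<in>crossings D. h x ` (strand 1 \<union> strand 2))) \<union>
     (\<Union>x\<in>crossings D. h x ` new_arcs (\<sigma> x))"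

definition placed_segments ::
    "diagram \<Rightarrow> (plane \<Rightarrow> plane \<Rightarrow> plane) \<Rightarrow> (plane \<Rightarrow> bool) \<Rightarrow> plane set" where
  "placed_segments D h \<sigma> = (\<Union>x\<in>crossings D. h x ` connecting_segment (\<sigma> x))"

end

theory Submission
  imports Defs "HOL-Complex_Analysis.Contour_Integration"
begin

text \<open>
  Every choice of smoothings turns the projection into finitely many disjoint circles, since the
  arcs of the diagram between the crossing disks together with the chords form a 2-regular graph.
  Fix a base point and choose the smoothings such that its circle contains the largest possible
  number of these arcs. If there were another circle, then, the projection being connected, at some
  crossing one chord would lie on the circle of the base point and the other chord would not.
  Taking the other smoothing there joins the two circles, contradicting the choice.
\<close>

subsection \<open>Arcs and loops\<close>

text \<open>A crossing has degree four in the plane, so the 2-regular graph is first built in the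
  source, where the circles are disjoint. Only its edges outside the crossing disks are carried to
  the plane, since \<open>param D\<close> is injective on them. Inside a disk the two strands have
  to lift to two disjoint edges of the graph. This is where transversality enters: it isolates each
  preimage of the crossing from the lift of the other strand. Edges are arcs, never loops, so a
  circle without crossings needs vertices too; these are auxiliary points which the disks have to
  avoid. The edges outside the disks are the same for all smoothings and therefore give a measure by
  which circles arising from different smoothings can be compared. Changing one smoothing keeps
  every such edge of the circle of the base point and gains the edge beyond the far end of the new
  chord.\<close>

definition arc_between :: "'a::topological_space set \<Rightarrow> 'a \<Rightarrow> 'a \<Rightarrow> bool" where
  "arc_between S u v \<longleftrightarrow> (\<exists>g. arc g \<and> path_image g = S \<and> pathstart g = u \<and> pathfinish g = v)"

lemma arc_between_sym: "arc_between S u v \<Longrightarrow> arc_between S v u"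
  unfolding arc_between_def
  by (metis arc_reversepath path_image_reversepath pathfinish_reversepath pathstart_reversepath)

lemma arc_between_ends: "arc_between S u v \<Longrightarrow> u \<in> S \<and> v \<in> S \<and> u \<noteq> v"
  unfolding arc_between_def
  by (metis arc_distinct_ends pathfinish_in_path_image pathstart_in_path_image)

lemma arc_between_compact: "arc_between S u v \<Longrightarrow> compact S"
  unfolding arc_between_def by (metis arc_imp_path compact_path_image)

lemma arc_between_connected: "arc_between S u v \<Longrightarrow> connected S"
  unfolding arc_between_def by (metis arc_imp_path connected_path_image)

lemma arc_between_continuous_image:
  assumes "arc_between S u v" "continuous_on S f" "inj_on f S"
  shows "arc_between (f ` S) (f u) (f v)"
proof -
  obtain g where g: "arc g" "path_image g = S" "pathstart g = u" "pathfinish g = v"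
    using assms(1) unfolding arc_between_def by blast
  have "path (f \<circ> g)"
    using g assms(2) by (auto intro: path_continuous_image arc_imp_path)
  moreover have "inj_on (f \<circ> g) {0..1}"
    using g assms(3) unfolding arc_def path_image_def by (metis comp_inj_on)
  ultimately show ?thesis
    unfolding arc_between_def arc_def
    by (intro exI[of _ "f \<circ> g"]) (use g in \<open>auto simp: path_image_compose pathstart_compose pathfinish_compose\<close>)
qed

lemma arc_between_segment:
  fixes a b :: "'a::real_normed_vector"
  assumes "a \<noteq> b"
  shows "arc_between (closed_segment a b) a b"
  unfolding arc_between_def using assms by (intro exI[of _ "linepath a b"]) auto

lemma arc_between_split:
  assumes S: "arc_between S u v" and p: "p \<in> S" "p \<noteq> u" "p \<noteq> v"
  obtains B C where "arc_between B u p" "arc_between C p v" "B \<union> C = S" "B \<inter> C = {p}"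
proof -
  obtain g where g: "arc g" "path_image g = S" "pathstart g = u" "pathfinish g = v"
    using S unfolding arc_between_def by blast
  obtain t where t: "0 \<le> t" "t \<le> 1" "g t = p"
    using p(1) g(2) by (auto simp: path_image_def)
  have t': "t \<noteq> 0" "t \<noteq> 1"
    using t p(2,3) g by (auto simp: pathstart_def pathfinish_def)
  have cont: "continuous_on {0..1} g" and inj: "inj_on g {0..1}"
    using g(1) by (auto simp: arc_def path_def)
  have "arc_between (g ` closed_segment 0 t) (g 0) (g t)"
    using t t' by (intro arc_between_continuous_image arc_between_segment
        continuous_on_subset[OF cont] inj_on_subset[OF inj]) (auto simp: closed_segment_eq_real_ivl)
  moreover have "arc_between (g ` closed_segment t 1) (g t) (g 1)"
    using t t' by (intro arc_between_continuous_image arc_between_segment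
        continuous_on_subset[OF cont] inj_on_subset[OF inj]) (auto simp: closed_segment_eq_real_ivl)
  moreover have "g ` closed_segment 0 t \<union> g ` closed_segment t 1 = S"
    unfolding g(2)[symmetric] path_image_def image_Un[symmetric]
    using t by (intro arg_cong[of _ _ "image g"]) (auto simp: closed_segment_eq_real_ivl)
  moreover have "g ` closed_segment 0 t \<inter> g ` closed_segment t 1 = g ` {t}"
  proof -
    have "g ` closed_segment 0 t \<inter> g ` closed_segment t 1
            = g ` (closed_segment 0 t \<inter> closed_segment t 1)"
      using t by (intro inj_on_image_Int[OF inj, symmetric]) (auto simp: closed_segment_eq_real_ivl)
    also have "closed_segment 0 t \<inter> closed_segment t 1 = {t}"
      using t by (auto simp: closed_segment_eq_real_ivl)
    finally show ?thesis .
  qed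
  ultimately show ?thesis
    using that t g by (simp add: pathstart_def pathfinish_def)
qed

lemma arc_between_join:
  assumes "arc_between S u v" "arc_between T v w" "S \<inter> T = {v}"
  shows "arc_between (S \<union> T) u w"
proof -
  obtain g g' where g: "arc g" "path_image g = S" "pathstart g = u" "pathfinish g = v"
    and g': "arc g'" "path_image g' = T" "pathstart g' = v" "pathfinish g' = w"
    using assms unfolding arc_between_def by blast
  then have "arc (g +++ g')"
    using assms(3) by (intro arc_join) auto
  then show ?thesis
    unfolding arc_between_def
    by (intro exI[of _ "g +++ g'"]) (use g g' in \<open>auto simp: path_image_join\<close>)
qed

definition loop_image :: "'a::topological_space set \<Rightarrow> bool" where
  "loop_image S \<longleftrightarrow> (\<exists>g. simple_path g \<and> pathfinish g = pathstart g \<and> path_image g = S)"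

lemma loop_image_join:
  assumes "arc_between S u v" "arc_between T v u" "S \<inter> T = {u, v}"
  shows "loop_image (S \<union> T)"
proof -
  obtain g g' where g: "arc g" "path_image g = S" "pathstart g = u" "pathfinish g = v"
    and g': "arc g'" "path_image g' = T" "pathstart g' = v" "pathfinish g' = u"
    using assms unfolding arc_between_def by blast
  then have "simple_path (g +++ g')"
    using assms(3) by (intro simple_path_join_loop) auto
  then show ?thesis
    unfolding loop_image_def
    by (intro exI[of _ "g +++ g'"]) (use g g' in \<open>auto simp: path_image_join\<close>)
qed

lemma loop_image_compact: "loop_image S \<Longrightarrow> compact S"
  unfolding loop_image_def by (metis compact_simple_path_image)

lemma loop_image_connected: "loop_image S \<Longrightarrow> connected S"
  unfolding loop_image_def by (metis connected_simple_path_image)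

lemma loop_image_split:
  fixes S :: "'a::real_normed_vector set"
  assumes "loop_image S" "a \<in> S" "b \<in> S" "a \<noteq> b"
  obtains B C where "arc_between B a b" "arc_between C b a" "B \<inter> C = {a, b}" "B \<union> C = S"
proof -
  obtain g where g: "simple_path g" "pathfinish g = pathstart g" "path_image g = S"
    using assms unfolding loop_image_def by blast
  then show ?thesis
    using exists_double_arc[of g a b] assms that unfolding arc_between_def by metis
qed

text \<open>The inverse parametrisation \<open>k\<close> maps \<open>T\<close> to a connected set of
  reals containing 0 and 1, hence onto \<open>{0..1}\<close>.\<close>

lemma arc_between_connected_subset:
  fixes S :: "'a::t2_space set"
  assumes S: "arc_between S u v" and T: "connected T" "T \<subseteq> S" "u \<in> T" "v \<in> T"
  shows "T = S"
proof -
  obtain g where g: "arc g" "path_image g = S" "pathstart g = u" "pathfinish g = v"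
    using S unfolding arc_between_def by blast
  obtain k where k: "homeomorphism {0..1} S g k"
    using homeomorphism_arc[OF g(1)] g(2) by metis
  have k01: "k u = 0" "k v = 1"
    using k g(3,4) by (auto simp: pathstart_def pathfinish_def homeomorphism_def)
  have "connected (k ` T)"
    using k T by (metis connected_continuous_image continuous_on_subset homeomorphism_def)
  moreover have "0 \<in> k ` T" "1 \<in> k ` T"
    using k01 T by (metis imageI)+
  ultimately have "{0..1} \<subseteq> k ` T"
    by (rule connected_contains_Icc)
  have "S \<subseteq> T"
  proof
    fix y assume y: "y \<in> S"
    then have "k y \<in> {0..1}" using k by (auto simp: homeomorphism_def)
    then obtain z where "z \<in> T" "k y = k z" using \<open>{0..1} \<subseteq> k ` T\<close> by blast
    then show "y \<in> T" using k y T(2) by (metis homeomorphism_apply2 subsetD)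
  qed
  then show ?thesis using T by blast
qed

text \<open>All three parts come from the open interval \<open>{0<..<1}\<close> under a
  parametrisation. Connectedness will confine the interior to a single edge of a graph; density then
  brings in the endpoints.\<close>

lemma arc_between_interior:
  fixes S :: "'a::topological_space set"
  assumes S: "arc_between S u v"
  shows "connected (S - {u, v})" "S - {u, v} \<noteq> {}" "S \<subseteq> closure (S - {u, v})"
proof -
  obtain g where g: "arc g" "path_image g = S" "pathstart g = u" "pathfinish g = v"
    using S unfolding arc_between_def by blast
  have inj: "inj_on g {0..1}" and cont: "continuous_on {0..1} g"
    using g by (auto simp: arc_def path_def)
  have "S - {u, v} = g ` {0..1} - g ` {0, 1}"
    using g by (auto simp: path_image_def pathstart_def pathfinish_def)
  also have "\<dots> = g ` ({0..1} - {0, 1})"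
    using inj_on_image_set_diff[OF inj, of "{0..1}" "{0, 1}"] by auto
  also have "{0..1} - {0, 1} = {0<..<1::real}" by auto
  finally have eq: "S - {u, v} = g ` {0<..<1}" .
  show "connected (S - {u, v})"
    unfolding eq by (intro connected_continuous_image continuous_on_subset[OF cont]) auto
  show "S - {u, v} \<noteq> {}" unfolding eq by auto
  have "g ` closure {0<..<1} \<subseteq> closure (g ` {0<..<1})"
    by (rule image_closure_subset) (use cont in \<open>auto intro: subsetD[OF closure_subset]\<close>)
  then show "S \<subseteq> closure (S - {u, v})"
    unfolding eq using g(2) by (simp add: path_image_def)
qed

text \<open>Removing an interior point disconnects an arc, removing an endpoint does not.\<close>

lemma arc_between_unique:
  fixes S :: "'a::t2_space set"
  assumes "arc_between S u v" "arc_between S u' v'"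
  shows "u' \<in> {u, v}"
proof (rule ccontr)
  assume u': "u' \<notin> {u, v}"
  obtain g where g: "arc g" "path_image g = S" "pathstart g = u'" "pathfinish g = v'"
    using assms unfolding arc_between_def by blast
  have inj: "inj_on g {0..1}" and cont: "continuous_on {0..1} g"
    using g by (auto simp: arc_def path_def)
  have "S - {u'} = g ` {0..1} - g ` {0}"
    using g by (auto simp: path_image_def pathstart_def)
  also have "\<dots> = g ` ({0..1} - {0})"
    using inj_on_image_set_diff[OF inj, of "{0..1}" "{0}"] by auto
  also have "{0..1} - {0} = {0<..1::real}" by auto
  finally have "connected (S - {u'})"
    by (auto intro!: connected_continuous_image continuous_on_subset[OF cont])
  then have "S - {u'} = S"
    using arc_between_connected_subset[OF assms(1)] arc_between_ends[OF assms(1)] u' by blast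
  then show False using arc_between_ends[OF assms(2)] by blast
qed

text \<open>One member \<open>T\<close> meeting \<open>S\<close> and the union of the other members
  are closed, cover \<open>S\<close> and share no point of it, so connectedness leaves nothing for
  the others.\<close>

lemma connected_subset_one_of_finite_closed:
  fixes S :: "'a::topological_space set"
  assumes "connected S" "S \<noteq> {}" "finite F" "\<And>T. T \<in> F \<Longrightarrow> closed T" "S \<subseteq> \<Union>F"
    and "\<And>T U. T \<in> F \<Longrightarrow> U \<in> F \<Longrightarrow> T \<noteq> U \<Longrightarrow> S \<inter> T \<inter> U = {}"
  obtains T where "T \<in> F" "S \<subseteq> T"
proof -
  obtain T where T: "T \<in> F" "S \<inter> T \<noteq> {}" using assms(2,5) by blast
  have "S \<inter> \<Union>(F - {T}) = {}"
  proof (rule ccontr)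
    assume "S \<inter> \<Union>(F - {T}) \<noteq> {}"
    moreover have "closed (\<Union>(F - {T}))" using assms(3,4) by (intro closed_Union) auto
    moreover have "S \<subseteq> T \<union> \<Union>(F - {T})" using assms(5) by blast
    moreover have "T \<inter> \<Union>(F - {T}) \<inter> S = {}" using assms(6) T(1) by blast
    ultimately show False
      using connected_closedD[OF assms(1), of T "\<Union>(F - {T})"] T assms(4) by blast
  qed
  then show ?thesis using that[OF T(1)] assms(5) by blast
qed


subsection \<open>Systems of arcs\<close>

text \<open>A 2-regular graph without loop edges, given by its set of vertices and its set of closed edges.\<close>

definition arc_system :: "'a::topological_space set \<Rightarrow> 'a set set \<Rightarrow> bool" where
  "arc_system V \<A> \<longleftrightarrow>
     finite \<A> \<and>
     (\<forall>a\<in>\<A>. \<exists>u v. arc_between a u v \<and> a \<inter> V = {u, v}) \<and>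
     (\<forall>a\<in>\<A>. \<forall>b\<in>\<A>. a \<noteq> b \<longrightarrow> a \<inter> b \<subseteq> V) \<and>
     (\<forall>v\<in>V. card {a\<in>\<A>. v \<in> a} = 2)"

lemma arc_systemD:
  assumes "arc_system V \<A>"
  shows "finite \<A>"
    "\<And>a. a \<in> \<A> \<Longrightarrow> \<exists>u v. arc_between a u v \<and> a \<inter> V = {u, v}"
    "\<And>a b. a \<in> \<A> \<Longrightarrow> b \<in> \<A> \<Longrightarrow> a \<noteq> b \<Longrightarrow> a \<inter> b \<subseteq> V"
    "\<And>v. v \<in> V \<Longrightarrow> card {a\<in>\<A>. v \<in> a} = 2"
  using assms unfolding arc_system_def by auto

lemma arc_system_other:
  assumes "arc_system V \<A>" "e \<in> \<A>" "v \<in> e" "v \<in> V"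
  obtains f where "f \<noteq> e" "{a\<in>\<A>. v \<in> a} = {e, f}"
proof -
  have "card {a\<in>\<A>. v \<in> a} = 2" using arc_systemD(4)[OF assms(1,4)] .
  then obtain x y where xy: "x \<noteq> y" "{a\<in>\<A>. v \<in> a} = {x, y}"
    by (metis card_2_iff)
  then have "e = x \<or> e = y" using assms(2,3) by blast
  then show ?thesis using that xy by (metis insert_commute)
qed

text \<open>
  Two arcs sharing a vertex form a loop, which splits off, or are merged into one arc.
\<close>

lemma arc_system_loops:
  fixes V :: "'a::topological_space set"
  assumes "arc_system V \<A>"
  shows "\<exists>\<C>. finite \<C> \<and> pairwise disjnt \<C> \<and> (\<forall>c\<in>\<C>. loop_image c) \<and> \<Union>\<C> = \<Union>\<A>"
  using assms
proof (induction "card \<A>" arbitrary: V \<A> rule: less_induct)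
  case less
  note sys = arc_systemD[OF less.prems]
  show ?case
  proof (cases "\<A> = {}")
    case True
    then show ?thesis by (intro exI[of _ "{}"]) auto
  next
    case False
    then obtain e where e: "e \<in> \<A>" by blast
    obtain u v where uv: "arc_between e u v" "e \<inter> V = {u, v}" using sys(2)[OF e] by blast
    have uvV: "u \<in> V" "v \<in> V" "u \<in> e" "v \<in> e" "u \<noteq> v"
      using uv arc_between_ends[OF uv(1)] by blast+
    obtain f where f: "f \<noteq> e" "{a\<in>\<A>. v \<in> a} = {e, f}"
      using arc_system_other[OF less.prems e \<open>v \<in> e\<close> \<open>v \<in> V\<close>] by blast
    have fA: "f \<in> \<A>" "v \<in> f" using f(2) by blast+
    obtain w where w: "arc_between f v w" "f \<inter> V = {v, w}"
      using sys(2)[OF fA(1)] fA(2) uvV(2) arc_between_sym by (metis IntI insertE singletonD insert_commute)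
    have wV: "w \<in> V" "w \<in> f" "w \<noteq> v" using w arc_between_ends[OF w(1)] by blast+
    \<comment> \<open>Distinct edges meet only in vertices, so \<open>w = u\<close> alone decides
      whether \<open>e\<close> and \<open>f\<close> close up to a loop.\<close>
    have efV: "e \<inter> f = {u, v} \<inter> {v, w}" using sys(3)[OF e fA(1)] f(1) uv(2) w(2) by blast
    have v_other: "v \<notin> a" if "a \<in> \<A> - {e, f}" for a using f(2) that by blast
    show ?thesis
    proof (cases "w = u")
      case True
      have u_ef: "{a\<in>\<A>. u \<in> a} = {e, f}"
      proof -
        obtain f' where "f' \<noteq> e" "{a\<in>\<A>. u \<in> a} = {e, f'}"
          using arc_system_other[OF less.prems e \<open>u \<in> e\<close> \<open>u \<in> V\<close>] by blast
        moreover have "f \<in> {a\<in>\<A>. u \<in> a}" using fA wV True by blast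
        ultimately show ?thesis using f(1) by blast
      qed
      have u_other: "u \<notin> a" if "a \<in> \<A> - {e, f}" for a using u_ef that by blast
      let ?A = "\<A> - {e, f}" and ?V = "V - {u, v}"
      have "arc_system ?V ?A"
        unfolding arc_system_def
      proof (intro conjI ballI impI)
        fix a assume "a \<in> ?A"
        then have "a \<inter> ?V = a \<inter> V" using u_other v_other by blast
        then show "\<exists>u v. arc_between a u v \<and> a \<inter> ?V = {u, v}"
          using sys(2)[of a] \<open>a \<in> ?A\<close> by auto
      next
        fix a b assume "a \<in> ?A" "b \<in> ?A" "a \<noteq> b"
        then show "a \<inter> b \<subseteq> ?V" using sys(3)[of a b] u_other v_other by blast
      next
        fix v' assume v': "v' \<in> ?V"
        then have "{a\<in>?A. v' \<in> a} = {a\<in>\<A>. v' \<in> a}" using uv(2) w(2) True by blast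
        then show "card {a\<in>?A. v' \<in> a} = 2" using sys(4)[of v'] v' by simp
      qed (use sys(1) in auto)
      moreover have "card ?A < card \<A>"
        using sys(1) e by (intro psubset_card_mono) auto
      ultimately obtain \<C> where C: "finite \<C>" "pairwise disjnt \<C>" "\<forall>c\<in>\<C>. loop_image c" "\<Union>\<C> = \<Union>?A"
        using less.hyps[of ?A ?V] by metis
      have "loop_image (e \<union> f)"
        using uv(1) w(1) True efV by (intro loop_image_join[of _ u v]) auto
      moreover have "disjnt (e \<union> f) c" if "c \<in> \<C>" for c
      proof -
        have "(e \<union> f) \<inter> a = {}" if a: "a \<in> ?A" for a
        proof -
          have "e \<inter> a \<subseteq> V" "f \<inter> a \<subseteq> V" using sys(3)[OF e] sys(3)[OF fA(1)] a by auto
          then show ?thesis using uv(2) w(2) True u_other[OF a] v_other[OF a] by auto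
        qed
        then show ?thesis using C(4) that unfolding disjnt_def by blast
      qed
      moreover have "\<Union>(insert (e \<union> f) \<C>) = \<Union>\<A>" using C(4) e fA by auto
      ultimately show ?thesis
        using C by (intro exI[of _ "insert (e \<union> f) \<C>"]) (auto simp: pairwise_insert disjnt_sym)
    next
      case False
      let ?A = "insert (e \<union> f) (\<A> - {e, f})" and ?V = "V - {v}"
      have efv: "e \<inter> f = {v}" using efV False uvV wV by blast
      have new: "(e \<union> f) \<inter> a \<subseteq> ?V" if a: "a \<in> \<A> - {e, f}" for a
      proof -
        have "e \<inter> a \<subseteq> V" "f \<inter> a \<subseteq> V" using sys(3)[OF e] sys(3)[OF fA(1)] a by auto
        then show ?thesis using v_other[OF a] by auto
      qed
      have "arc_system ?V ?A"
        unfolding arc_system_def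
      proof (intro conjI ballI impI)
        fix a assume a: "a \<in> ?A"
        show "\<exists>u v. arc_between a u v \<and> a \<inter> ?V = {u, v}"
        proof (cases "a = e \<union> f")
          case True
          have "arc_between a u w"
            unfolding True by (rule arc_between_join[OF uv(1) w(1) efv])
          moreover have "a \<inter> ?V = {u, w}" using True uv(2) w(2) uvV wV by blast
          ultimately show ?thesis by blast
        next
          case False
          then have "a \<inter> ?V = a \<inter> V" using a v_other by blast
          then show ?thesis using sys(2)[of a] a False by auto
        qed
      next
        fix a b assume "a \<in> ?A" "b \<in> ?A" "a \<noteq> b"
        then consider "a = e \<union> f" "b \<in> \<A> - {e, f}" | "b = e \<union> f" "a \<in> \<A> - {e, f}"
          | "a \<in> \<A> - {e, f}" "b \<in> \<A> - {e, f}" by blast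
        then show "a \<inter> b \<subseteq> ?V"
        proof cases
          case 1 then show ?thesis using new by blast
        next
          case 2 then show ?thesis using new by blast
        next
          case 3 then show ?thesis using sys(3)[of a b] \<open>a \<noteq> b\<close> v_other by blast
        qed
      next
        fix v' assume v': "v' \<in> ?V"
        have vef: "v' \<notin> e \<or> v' \<notin> f" using efv v' by blast
        \<comment> \<open>The degree count needs the merged arc to be a new member: were it an edge
          already, \<open>insert\<close> would add nothing and a degree would drop.\<close>
        have notef: "e \<union> f \<notin> \<A>"
        proof
          assume "e \<union> f \<in> \<A>"
          then have "e \<union> f = e \<or> e \<union> f = f" using v_other[of "e \<union> f"] uvV by auto
          moreover have "w \<notin> e" using uv(2) wV False by auto
          moreover have "u \<notin> f" using w(2) uvV False by auto
          ultimately show False using wV uvV by auto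
        qed
        let ?S = "{a\<in>\<A>. v' \<in> a}"
        \<comment> \<open>\<open>e'\<close> will be whichever of \<open>e\<close> and
          \<open>f\<close> contains \<open>v'\<close>; the merged arc takes its place among the
          edges at \<open>v'\<close>.\<close>
        have replace: "card {a\<in>?A. v' \<in> a} = card ?S"
          if "e' \<in> ?S" "{a\<in>?A. v' \<in> a} = insert (e \<union> f) (?S - {e'})" for e'
        proof -
          have fin: "finite ?S" using sys(1) by simp
          have "card {a\<in>?A. v' \<in> a} = Suc (card (?S - {e'}))"
            unfolding that(2) by (rule card_insert_disjoint) (use fin notef in auto)
          also have "\<dots> = card ?S" by (rule card_Suc_Diff1[OF fin that(1)])
          finally show ?thesis .
        qed
        consider "v' \<notin> e" "v' \<notin> f" | "v' \<in> e" "v' \<notin> f" | "v' \<notin> e" "v' \<in> f"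
          using vef by blast
        then have "card {a\<in>?A. v' \<in> a} = card ?S"
        proof cases
          case 1
          then have "{a\<in>?A. v' \<in> a} = ?S" by auto
          then show ?thesis by (rule arg_cong)
        next
          case 2
          then show ?thesis using e by (intro replace[of e]) auto
        next
          case 3
          then show ?thesis using fA by (intro replace[of f]) auto
        qed
        then show "card {a\<in>?A. v' \<in> a} = 2" using sys(4)[of v'] v' by simp
      qed (use sys(1) in auto)
      moreover have "card ?A < card \<A>"
      proof -
        have "card {e, f} = 2" "{e, f} \<subseteq> \<A>" using f(1) e fA by auto
        then have "card (\<A> - {e, f}) = card \<A> - 2" "card \<A> \<ge> 2"
          using card_Diff_subset[of "{e, f}" \<A>] card_mono[of \<A> "{e, f}"] sys(1) by auto
        moreover have "card ?A \<le> Suc (card (\<A> - {e, f}))" by (rule card_insert_le_m1) auto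
        ultimately show ?thesis by linarith
      qed
      ultimately obtain \<C> where "finite \<C>" "pairwise disjnt \<C>" "\<forall>c\<in>\<C>. loop_image c" "\<Union>\<C> = \<Union>?A"
        using less.hyps[of ?A ?V] by metis
      moreover have "\<Union>?A = \<Union>\<A>" using e fA by blast
      ultimately show ?thesis by auto
    qed
  qed
qed

lemma arc_system_subdivide:
  assumes A: "arc_system V \<A>" and p: "p \<in> \<Union>\<A>"
  shows "\<exists>\<B>. arc_system (insert p V) \<B> \<and> \<Union>\<B> = \<Union>\<A>"
proof (cases "p \<in> V")
  case True
  then show ?thesis using A by (auto simp: insert_absorb)
next
  case pV: False
  note sys = arc_systemD[OF A]
  obtain a where a: "a \<in> \<A>" "p \<in> a" using p by blast
  obtain u v where uv: "arc_between a u v" "a \<inter> V = {u, v}" using sys(2)[OF a(1)] by blast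
  have uvV: "u \<in> V" "v \<in> V" "u \<noteq> v" using uv arc_between_ends[OF uv(1)] by blast+
  obtain b c where bc: "arc_between b u p" "arc_between c p v" "b \<union> c = a" "b \<inter> c = {p}"
    using arc_between_split[OF uv(1) a(2)] pV uvV by metis
  have ends: "u \<in> b" "v \<in> c" "p \<in> b" "p \<in> c" "b \<noteq> c"
    using arc_between_ends[OF bc(1)] arc_between_ends[OF bc(2)] bc(4) by blast+
  have p_other: "p \<notin> d" if "d \<in> \<A> - {a}" for d using sys(3)[of a d] a pV that by blast
  have bcA: "b \<notin> \<A> - {a}" "c \<notin> \<A> - {a}" using p_other ends by blast+
  let ?B = "insert b (insert c (\<A> - {a}))"
  \<comment> \<open>\<open>\<phi>\<close> sends each new edge to the old edge containing it. A
    vertex other than \<open>p\<close> lies in at most one of \<open>b\<close> and \<open>c\<close>,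
    so \<open>\<phi>\<close> is injective on the edges at that vertex and its degree is
    unchanged.\<close>
  define \<phi> where "\<phi> d = (if d = b \<or> d = c then a else d)" for d
  have "arc_system (insert p V) ?B"
    unfolding arc_system_def
  proof (intro conjI ballI impI)
    fix d assume d: "d \<in> ?B"
    have "b \<inter> insert p V = {u, p}" using uv(2) bc ends uvV pV by blast
    moreover have "c \<inter> insert p V = {p, v}" using uv(2) bc ends uvV pV by blast
    moreover have "\<exists>u v. arc_between d u v \<and> d \<inter> insert p V = {u, v}" if "d \<in> \<A> - {a}"
      using sys(2)[of d] that p_other[OF that] by auto
    ultimately show "\<exists>u v. arc_between d u v \<and> d \<inter> insert p V = {u, v}"
      using d bc(1,2) by blast
  next
    fix d d' assume d: "d \<in> ?B" "d' \<in> ?B" "d \<noteq> d'"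
    have "a \<inter> x \<subseteq> V" if "x \<in> \<A> - {a}" for x using sys(3)[of a x] a that by blast
    moreover have "x \<inter> y \<subseteq> V" if "x \<in> \<A> - {a}" "y \<in> \<A> - {a}" "x \<noteq> y" for x y
      using sys(3)[of x y] that by blast
    ultimately show "d \<inter> d' \<subseteq> insert p V"
      using d bc(3,4) by (elim insertE) blast+
  next
    fix v' assume v': "v' \<in> insert p V"
    show "card {d\<in>?B. v' \<in> d} = 2"
    proof (cases "v' = p")
      case True
      then have "{d\<in>?B. v' \<in> d} = {b, c}" using ends p_other by blast
      then show ?thesis using ends(5) by simp
    next
      case False
      have v'V: "v' \<in> V" using False v' by blast
      let ?D = "{d\<in>?B. v' \<in> d}"
      have "card ?D = card (\<phi> ` ?D)"
        by (rule card_image[symmetric]) (use False bc(4) bcA in \<open>auto simp: inj_on_def \<phi>_def\<close>)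
      also have "\<phi> ` ?D = {d\<in>\<A>. v' \<in> d}"
      proof
        show "\<phi> ` ?D \<subseteq> {d\<in>\<A>. v' \<in> d}" using a bc(3) by (auto simp: \<phi>_def)
        show "{d\<in>\<A>. v' \<in> d} \<subseteq> \<phi> ` ?D"
        proof
          fix d assume d: "d \<in> {d\<in>\<A>. v' \<in> d}"
          show "d \<in> \<phi> ` ?D"
          proof (cases "d = a")
            case True
            then have "b \<in> ?D \<or> c \<in> ?D" using d bc(3) by blast
            moreover have "\<phi> b = d" "\<phi> c = d" using True by (auto simp: \<phi>_def)
            ultimately show ?thesis by blast
          next
            case False
            then have "d \<in> ?D" "\<phi> d = d" using d bcA by (auto simp: \<phi>_def)
            then show ?thesis by (metis imageI)
          qed
        qed
      qed
      also have "card {d\<in>\<A>. v' \<in> d} = 2" by (rule sys(4)[OF v'V])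
      finally show ?thesis .
    qed
  qed (use sys(1) in auto)
  moreover have "\<Union>?B = \<Union>\<A>" using a(1) bc(3) by blast
  ultimately show ?thesis by blast
qed

lemma arc_system_refine:
  assumes "finite F" "arc_system V \<A>" "F \<subseteq> \<Union>\<A>"
  shows "\<exists>\<B>. arc_system (V \<union> F) \<B> \<and> \<Union>\<B> = \<Union>\<A>"
  using assms
proof (induction F rule: finite_induct)
  case empty
  then show ?case by auto
next
  case (insert p F)
  then obtain \<B> where "arc_system (V \<union> F) \<B>" "\<Union>\<B> = \<Union>\<A>"
    using insert.IH[OF insert.prems(1)] insert.prems(2) by (metis insert_subset)
  then show ?case using arc_system_subdivide[of "V \<union> F" \<B> p] insert.prems by auto
qed

text \<open>This recognises edges without knowing how the graph was produced. The interior of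
  \<open>s\<close> is connected and avoids the vertices, so it lies in one edge \<open>a\<close>; by
  density so does \<open>s\<close>. The ends of \<open>s\<close> are then the ends of
  \<open>a\<close>, and a connected subset of an arc containing both ends is the whole arc.\<close>

lemma arc_system_member:
  fixes V :: "'a::t2_space set"
  assumes A: "arc_system V \<A>" and s: "arc_between s u v" "s \<inter> V = {u, v}" "s \<subseteq> \<Union>\<A>"
  shows "s \<in> \<A>"
proof -
  note sys = arc_systemD[OF A] and int = arc_between_interior[OF s(1)]
  have closed: "closed a" if "a \<in> \<A>" for a
    using sys(2)[OF that] arc_between_compact compact_imp_closed by blast
  obtain a where a: "a \<in> \<A>" "s - {u, v} \<subseteq> a"
  proof (rule connected_subset_one_of_finite_closed[OF int(1,2) sys(1) closed])
    show "s - {u, v} \<subseteq> \<Union>\<A>" using s(3) by blast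
    show "(s - {u, v}) \<inter> T \<inter> U = {}" if "T \<in> \<A>" "U \<in> \<A>" "T \<noteq> U" for T U
      using sys(3)[OF that] s(2) by blast
  qed
  have "s \<subseteq> a" using int(3) closure_minimal[OF a(2) closed[OF a(1)]] by blast
  obtain u' v' where a': "arc_between a u' v'" "a \<inter> V = {u', v'}" using sys(2)[OF a(1)] by blast
  have "{u, v} \<subseteq> {u', v'}" "u \<noteq> v"
    using a' s(2) \<open>s \<subseteq> a\<close> arc_between_ends[OF s(1)] by blast+
  then have "u' \<in> s" "v' \<in> s" using arc_between_ends[OF s(1)] by auto
  then have "s = a"
    using arc_between_connected_subset[OF a'(1) arc_between_connected[OF s(1)] \<open>s \<subseteq> a\<close>] by blast
  then show ?thesis using a(1) by simp
qed

lemma arc_system_two_arcs: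
  fixes B :: "'a::t2_space set"
  assumes "arc_between B u v" "arc_between C v u" "B \<inter> C = {u, v}"
  shows "arc_system {u, v} {B, C}"
proof -
  \<comment> \<open>If the arcs were equal, \<open>B\<close> would consist of its two
    endpoints.\<close>
  have "B \<noteq> C" using arc_between_interior(2)[OF assms(1)] assms(3) by blast
  moreover have "{a\<in>{B, C}. u \<in> a} = {B, C}" "{a\<in>{B, C}. v \<in> a} = {B, C}"
    using assms(3) by blast+
  ultimately show ?thesis
    using assms unfolding arc_system_def by (auto simp: insert_commute)
qed

lemma arc_system_Un:
  assumes "arc_system V \<A>" "arc_system W \<B>" "\<Union>\<A> \<inter> \<Union>\<B> = {}" "V \<subseteq> \<Union>\<A>" "W \<subseteq> \<Union>\<B>"
  shows "arc_system (V \<union> W) (\<A> \<union> \<B>)"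
  unfolding arc_system_def
proof (intro conjI ballI impI)
  note A = arc_systemD[OF assms(1)] and B = arc_systemD[OF assms(2)]
  show "finite (\<A> \<union> \<B>)" using A(1) B(1) by simp
  show "\<exists>u v. arc_between a u v \<and> a \<inter> (V \<union> W) = {u, v}" if "a \<in> \<A> \<union> \<B>" for a
  proof -
    have "a \<inter> (V \<union> W) = a \<inter> V" if "a \<in> \<A>" using that assms(3,5) by blast
    moreover have "a \<inter> (V \<union> W) = a \<inter> W" if "a \<in> \<B>" using that assms(3,4) by blast
    ultimately show ?thesis using A(2) B(2) that by (metis UnE)
  qed
  show "a \<inter> b \<subseteq> V \<union> W" if "a \<in> \<A> \<union> \<B>" "b \<in> \<A> \<union> \<B>" "a \<noteq> b" for a b
    using that A(3)[of a b] B(3)[of a b] assms(3) by blast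
  show "card {a\<in>\<A> \<union> \<B>. v \<in> a} = 2" if "v \<in> V \<union> W" for v
  proof -
    have "{a\<in>\<A> \<union> \<B>. v \<in> a} = {a\<in>\<A>. v \<in> a}" if "v \<in> V" using that assms(3,4) by blast
    moreover have "{a\<in>\<A> \<union> \<B>. v \<in> a} = {a\<in>\<B>. v \<in> a}" if "v \<in> W" using that assms(3,5) by blast
    ultimately show ?thesis using A(4) B(4) that by (metis UnE)
  qed
qed

text \<open>Cutting the loop at \<open>u\<close> and \<open>v\<close> gives a graph with two edges.
  By \<open>arc_system_member\<close> the arc \<open>s\<close> is one of them, and \<open>d\<close>
  is the other.\<close>

lemma loop_image_remove_arc:
  fixes K :: "'a::real_normed_vector set"
  assumes "loop_image K" "arc_between s u v" "s \<subseteq> K"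
  obtains d where "arc_between d u v" "s \<union> d = K" "s \<inter> d = {u, v}"
proof -
  have ends: "u \<in> s" "v \<in> s" "u \<noteq> v" using arc_between_ends[OF assms(2)] by auto
  obtain B C where BC: "arc_between B u v" "arc_between C v u" "B \<inter> C = {u, v}" "B \<union> C = K"
    using loop_image_split[OF assms(1)] ends assms(3) by (metis subsetD)
  have "s \<in> {B, C}"
    using assms(2,3) BC(4) ends by (intro arc_system_member[OF arc_system_two_arcs[OF BC(1-3)] assms(2)]) auto
  then show ?thesis
    using that BC arc_between_sym by (metis Int_commute Un_commute insertE singletonD)
qed

text \<open>The loops from \<open>arc_system_loops\<close> are finitely many disjoint closed
  connected sets, hence they are exactly the components.\<close>

lemma arc_system_component:
  fixes V :: "'a::t2_space set"
  assumes "arc_system V \<A>" "p \<in> \<Union>\<A>"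
  shows "loop_image (connected_component_set (\<Union>\<A>) p)"
proof -
  obtain \<C> where C: "finite \<C>" "pairwise disjnt \<C>" "\<forall>c\<in>\<C>. loop_image c" "\<Union>\<C> = \<Union>\<A>"
    using arc_system_loops[OF assms(1)] by metis
  obtain c where c: "c \<in> \<C>" "p \<in> c" using assms(2) C(4) by blast
  let ?K = "connected_component_set (\<Union>\<A>) p"
  have K: "connected ?K" "p \<in> ?K" "?K \<subseteq> \<Union>\<C>"
    using assms(2) C(4) connected_component_subset[of "\<Union>\<A>" p] by (auto simp: connected_component_refl_eq)
  obtain c' where c': "c' \<in> \<C>" "?K \<subseteq> c'"
  proof (rule connected_subset_one_of_finite_closed[OF K(1) _ C(1) _ K(3)])
    show "?K \<noteq> {}" using K(2) by blast
    show "closed T" if "T \<in> \<C>" for T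
      using C(3) that loop_image_compact compact_imp_closed by blast
    show "?K \<inter> T \<inter> U = {}" if "T \<in> \<C>" "U \<in> \<C>" "T \<noteq> U" for T U
      using C(2) that by (auto simp: pairwise_def disjnt_def)
  qed
  have "p \<in> c'" using c' K(2) by blast
  then have "c' = c" using c c'(1) C(2) by (auto simp: pairwise_def disjnt_def)
  moreover have "c \<subseteq> ?K"
    using C(3,4) c loop_image_connected by (intro connected_component_maximal) auto
  ultimately show ?thesis using c' C(3) by (metis subset_antisym)
qed


subsection \<open>The model of a crossing\<close>

lemma mem_strand:
  "v \<in> strand 1 \<longleftrightarrow> v $ 2 = 0 \<and> \<bar>v $ 1\<bar> \<le> 1"
  "v \<in> strand 2 \<longleftrightarrow> v $ 1 = 0 \<and> \<bar>v $ 2\<bar> \<le> 1"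
proof -
  have eq: "v \<in> strand i \<longleftrightarrow> (\<exists>t. \<bar>t\<bar> \<le> 1 \<and> v = t *\<^sub>R axis i 1)" for i
  proof
    assume "v \<in> strand i"
    then obtain u where u: "0 \<le> u" "u \<le> 1" "v = (1 - u) *\<^sub>R (- axis i 1) + u *\<^sub>R axis i 1"
      unfolding strand_def closed_segment_def by blast
    then have "v = (2 * u - 1) *\<^sub>R axis i 1" by (simp add: algebra_simps flip: scaleR_add_left)
    then show "\<exists>t. \<bar>t\<bar> \<le> 1 \<and> v = t *\<^sub>R axis i 1"
      using u by (intro exI[of _ "2 * u - 1"]) auto
  next
    assume "\<exists>t. \<bar>t\<bar> \<le> 1 \<and> v = t *\<^sub>R axis i 1"
    then obtain t where t: "\<bar>t\<bar> \<le> 1" "v = t *\<^sub>R axis i 1" by blast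
    have "t *\<^sub>R axis i (1::real) = (1 - (t + 1) / 2) *\<^sub>R (- axis i 1) + ((t + 1) / 2) *\<^sub>R axis i 1"
      by (simp add: vec_eq_iff field_simps)
    then show "v \<in> strand i"
      unfolding strand_def closed_segment_def using t by (intro CollectI exI[of _ "(t + 1) / 2"]) auto
  qed
  show "v \<in> strand 1 \<longleftrightarrow> v $ 2 = 0 \<and> \<bar>v $ 1\<bar> \<le> 1"
    unfolding eq by (auto simp: vec_eq_iff forall_2 axis_def)
  show "v \<in> strand 2 \<longleftrightarrow> v $ 1 = 0 \<and> \<bar>v $ 2\<bar> \<le> 1"
    unfolding eq by (auto simp: vec_eq_iff forall_2 axis_def)
qed

text \<open>The sign that tells the two smoothings apart: the connecting segment lies on the line
  through 0 with this slope, and the chords are perpendicular to it.\<close>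

definition slope :: "bool \<Rightarrow> real" where
  "slope b = (if b then 1 else - 1)"

text \<open>Labelling the two arcs of a smoothing by a Boolean makes "the other chord at this
  crossing" expressible as \<open>\<not> k\<close>.\<close>

definition chord :: "bool \<Rightarrow> bool \<Rightarrow> plane set" where
  "chord b k = (if k then closed_segment (axis 1 1) (smoothing_end b)
                else closed_segment (- axis 1 1) (- smoothing_end b))"

text \<open>These four points become vertices of the graph: here the chords of either smoothing meet
  the rest of the diagram.\<close>

definition ports :: "plane set" where
  "ports = {axis 1 1, - axis 1 1, axis 2 1, - axis 2 1}"

lemma new_arcs_eq: "new_arcs b = (\<Union>k. chord b k)"
  by (auto simp: new_arcs_def chord_def)

lemma smoothing_end_eq: "smoothing_end b = slope b *\<^sub>R axis 2 1"
  by (simp add: smoothing_end_def slope_def)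

lemma mem_chord:
  "v \<in> chord b True \<longleftrightarrow> 0 \<le> v $ 1 \<and> v $ 1 \<le> 1 \<and> v $ 2 = slope b * (1 - v $ 1)"
  "v \<in> chord b False \<longleftrightarrow> - 1 \<le> v $ 1 \<and> v $ 1 \<le> 0 \<and> v $ 2 = - slope b * (1 + v $ 1)"
proof -
  have T: "v \<in> chord b True \<longleftrightarrow> 0 \<le> v $ 1 \<and> v $ 1 \<le> 1 \<and> v $ 2 = slope b * (1 - v $ 1)" for v
  proof
    assume "v \<in> chord b True"
    then obtain u where "0 \<le> u" "u \<le> 1" "v = (1 - u) *\<^sub>R axis 1 1 + u *\<^sub>R smoothing_end b"
      unfolding chord_def closed_segment_def by auto
    then show "0 \<le> v $ 1 \<and> v $ 1 \<le> 1 \<and> v $ 2 = slope b * (1 - v $ 1)"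
      by (auto simp: smoothing_end_eq axis_def)
  next
    assume *: "0 \<le> v $ 1 \<and> v $ 1 \<le> 1 \<and> v $ 2 = slope b * (1 - v $ 1)"
    then have "v = (1 - (1 - v $ 1)) *\<^sub>R axis 1 1 + (1 - v $ 1) *\<^sub>R smoothing_end b"
      by (simp add: vec_eq_iff forall_2 smoothing_end_eq axis_def)
    then show "v \<in> chord b True"
      unfolding chord_def closed_segment_def using * by (auto intro!: exI[of _ "1 - v $ 1"])
  qed
  show "v \<in> chord b True \<longleftrightarrow> 0 \<le> v $ 1 \<and> v $ 1 \<le> 1 \<and> v $ 2 = slope b * (1 - v $ 1)"
    by (rule T)
  have "chord b False = uminus ` chord b True"
    using closed_segment_linear_image[of uminus "axis 1 1" "smoothing_end b"]
    by (simp add: chord_def module_hom_uminus linear_uminus)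
  then have "v \<in> chord b False \<longleftrightarrow> - v \<in> chord b True"
    by (metis (no_types, lifting) add.inverse_inverse image_iff)
  then show "v \<in> chord b False \<longleftrightarrow> - 1 \<le> v $ 1 \<and> v $ 1 \<le> 0 \<and> v $ 2 = - slope b * (1 + v $ 1)"
    unfolding T by auto
qed

lemma mem_connecting_segment:
  "v \<in> connecting_segment b \<longleftrightarrow> \<bar>v $ 1\<bar> \<le> 1 / 2 \<and> v $ 2 = slope b * v $ 1"
proof
  assume "v \<in> connecting_segment b"
  then obtain u where u: "0 \<le> u" "u \<le> 1"
      "v = (1 - u) *\<^sub>R midpoint (axis 1 1) (smoothing_end b) + u *\<^sub>R midpoint (- axis 1 1) (- smoothing_end b)"
    unfolding connecting_segment_def closed_segment_def by blast
  have "v $ 1 = 1 / 2 - u" "v $ 2 = slope b * (1 / 2 - u)"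
    unfolding u(3) by (simp_all add: smoothing_end_eq axis_def midpoint_def field_simps)
  then show "\<bar>v $ 1\<bar> \<le> 1 / 2 \<and> v $ 2 = slope b * v $ 1" using u(1,2) by (auto simp: abs_if)
next
  assume *: "\<bar>v $ 1\<bar> \<le> 1 / 2 \<and> v $ 2 = slope b * v $ 1"
  have "v = (1 - (1 / 2 - v $ 1)) *\<^sub>R midpoint (axis 1 1) (smoothing_end b)
      + (1 / 2 - v $ 1) *\<^sub>R midpoint (- axis 1 1) (- smoothing_end b)"
    using conjunct2[OF *] by (simp add: vec_eq_iff forall_2 smoothing_end_eq axis_def midpoint_def field_simps)
  then show "v \<in> connecting_segment b"
    unfolding connecting_segment_def closed_segment_def using *
    by (intro CollectI exI[of _ "1 / 2 - v $ 1"]) auto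
qed

lemma mem_ports: "v \<in> ports \<longleftrightarrow> (v $ 1, v $ 2) \<in> {(1, 0), (- 1, 0), (0, 1), (0, - 1)}"
  by (auto simp: ports_def vec_eq_iff forall_2 axis_def)

lemma unit_segment_subset:
  assumes "norm a \<le> 1" "norm b \<le> 1"
  shows "closed_segment a b \<subseteq> cball (0::'a::real_normed_vector) 1"
  using assms by (intro closed_segment_subset) auto

lemma strand_subset: "strand i \<subseteq> cball 0 1"
  unfolding strand_def by (intro unit_segment_subset) auto

lemma norm_smoothing_end: "norm (smoothing_end b) = 1"
  by (simp add: smoothing_end_def)

lemma chord_subset: "chord b k \<subseteq> cball 0 1"
  by (simp add: chord_def unit_segment_subset norm_smoothing_end)

lemma connecting_segment_subset: "connecting_segment b \<subseteq> cball 0 1"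
proof -
  have "norm (midpoint x y) \<le> 1" if "norm x = 1" "norm y = 1" for x y :: plane
    using norm_triangle_ineq[of x y] that by (simp add: midpoint_def)
  then show ?thesis
    by (simp add: connecting_segment_def unit_segment_subset norm_smoothing_end)
qed

lemma ports_subset: "ports \<subseteq> strand 1 \<union> strand 2"
  by (auto simp: mem_ports mem_strand)

lemma strand_Int_strand: "strand 1 \<inter> strand 2 = {0}"
  by (auto simp: mem_strand vec_eq_iff forall_2)

lemma strand_Int_ports: "strand i \<inter> ports = {axis i 1, - axis i 1}"
  using exhaust_2[of i] by (auto simp: mem_ports mem_strand vec_eq_iff forall_2 axis_def)

lemma chord_Int_chord: "chord b True \<inter> chord b False = {}"
  by (auto simp: mem_chord slope_def split: if_splits)

lemma chord_ends:
  obtains u v where "arc_between (chord b k) u v" "chord b k \<inter> ports = {u, v}"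
proof (cases k)
  case True
  have "arc_between (chord b k) (axis 1 1) (smoothing_end b)"
    unfolding chord_def using True
    by (auto intro!: arc_between_segment simp: smoothing_end_eq slope_def vec_eq_iff forall_2 axis_def)
  moreover have "chord b k \<inter> ports = {axis 1 1, smoothing_end b}"
    using True by (auto simp: mem_ports mem_chord vec_eq_iff forall_2 axis_def smoothing_end_eq slope_def)
  ultimately show ?thesis by (rule that)
next
  case False
  have "arc_between (chord b k) (- axis 1 1) (- smoothing_end b)"
    unfolding chord_def using False
    by (auto intro!: arc_between_segment simp: smoothing_end_eq slope_def vec_eq_iff forall_2 axis_def)
  moreover have "chord b k \<inter> ports = {- axis 1 1, - smoothing_end b}"
    using False by (auto simp: mem_ports mem_chord vec_eq_iff forall_2 axis_def smoothing_end_eq slope_def)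
  ultimately show ?thesis by (rule that)
qed

lemma port_in_unique_chord:
  assumes "v \<in> ports"
  shows "\<exists>k. \<forall>k'. v \<in> chord b k' \<longleftrightarrow> k' = k"
proof -
  have "v \<in> chord b True \<or> v \<in> chord b False"
    using assms by (auto simp: mem_ports mem_chord slope_def)
  then show ?thesis using chord_Int_chord[of b] by (metis (full_types) IntI empty_iff)
qed

text \<open>Each chord of one smoothing has its ends on different chords of the other smoothing.
  This is why changing a smoothing can join two circles.\<close>

lemma chord_flip:
  obtains k' u v where "u \<in> ports" "v \<in> ports" "u \<in> chord b k" "v \<notin> chord b k" "u \<in> chord (\<not> b) k'" "v \<in> chord (\<not> b) k'"
proof (cases k)
  case True
  have "axis 1 1 \<in> chord b k" "- smoothing_end b \<notin> chord b k"
    "axis 1 1 \<in> chord (\<not> b) True" "- smoothing_end b \<in> chord (\<not> b) True"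
    "axis 1 1 \<in> ports" "- smoothing_end b \<in> ports"
    using True by (auto simp: mem_ports mem_chord axis_def smoothing_end_eq slope_def)
  then show ?thesis using that by blast
next
  case False
  have "- axis 1 1 \<in> chord b k" "smoothing_end b \<notin> chord b k"
    "- axis 1 1 \<in> chord (\<not> b) False" "smoothing_end b \<in> chord (\<not> b) False"
    "- axis 1 1 \<in> ports" "smoothing_end b \<in> ports"
    using False by (auto simp: mem_ports mem_chord axis_def smoothing_end_eq slope_def)
  then show ?thesis using that by blast
qed

lemma chord_not_subset_strands: "\<not> chord b k \<subseteq> strand 1 \<union> strand 2"
proof -
  \<comment> \<open>\<open>v\<close> is the midpoint of the chord; both its coordinates are nonzero,
    whereas the strands lie on the axes.\<close>
  define c :: real where "c = (if k then 1 / 2 else - 1 / 2)"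
  define v :: plane where "v = vector [c, slope b * c]"
  have "v \<in> chord b k" "v \<notin> strand 1 \<union> strand 2"
    by (cases k; auto simp: v_def c_def mem_chord mem_strand slope_def)+
  then show ?thesis by blast
qed

lemma connecting_segment_ends:
  obtains u v where "arc_between (connecting_segment b) u v" "connecting_segment b \<inter> new_arcs b = {u, v}"
proof -
  let ?m = "midpoint (axis 1 1) (smoothing_end b)" and ?n = "midpoint (- axis 1 1) (- smoothing_end b)"
  have "arc_between (connecting_segment b) ?m ?n"
    unfolding connecting_segment_def
    by (auto intro!: arc_between_segment
        simp: smoothing_end_eq slope_def vec_eq_iff forall_2 axis_def midpoint_def)
  moreover have "connecting_segment b \<inter> new_arcs b = {?m, ?n}"
  proof -
    have "v \<in> connecting_segment b \<and> v \<in> chord b True \<longleftrightarrow> v = ?m" for v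
      by (auto simp: mem_connecting_segment mem_chord vec_eq_iff forall_2 axis_def midpoint_def
          smoothing_end_eq slope_def)
    moreover have "v \<in> connecting_segment b \<and> v \<in> chord b False \<longleftrightarrow> v = ?n" for v
      by (auto simp: mem_connecting_segment mem_chord vec_eq_iff forall_2 axis_def midpoint_def
          smoothing_end_eq slope_def)
    ultimately show ?thesis unfolding new_arcs_eq UNIV_bool by blast
  qed
  ultimately show ?thesis by (rule that)
qed


subsection \<open>Crossing disks\<close>

lemma compact_source: "compact (source D)"
  unfolding source_def by (rule compact_Times[OF finite_imp_compact compact_sphere]) simp

text \<open>The smaller disk is \<open>h\<close> precomposed with scaling by \<open>r\<close>, which
  preserves the directions of the strands. The delicate point is that the curve near a preimage of
  \<open>x\<close> must lie on the shortened strand.\<close>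

lemma crossing_disk_shrink:
  assumes D: "continuous_on (source D) (param D)" and h: "crossing_disk D x h" and U: "open U" "x \<in> U"
  obtains h' where "crossing_disk D x h'" "h' ` cball 0 1 \<subseteq> U"
proof -
  have h1: "continuous_on (cball 0 1) h" "inj_on h (cball 0 1)" "h 0 = x"
    "projection D \<inter> h ` cball 0 1 = h ` (strand 1 \<union> strand 2)"
    using h unfolding crossing_disk_def by auto
  obtain p q where pq: "preimages D x = {p, q}"
    "\<forall>\<^sub>F z in at p within source D. param D z \<in> h ` strand 1"
    "\<forall>\<^sub>F z in at q within source D. param D z \<in> h ` strand 2"
    using h unfolding crossing_disk_def by auto
  obtain d where d: "d > 0" "\<And>z. z \<in> cball 0 1 \<Longrightarrow> dist z 0 < d \<Longrightarrow> h z \<in> U"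
  proof -
    obtain e where e: "e > 0" "ball x e \<subseteq> U" using U open_contains_ball by blast
    obtain d where "d > 0" "\<forall>z\<in>cball 0 1. dist z 0 < d \<longrightarrow> dist (h z) (h 0) < e"
      using h1(1) e(1) unfolding continuous_on_iff by (metis centre_in_cball zero_le_one)
    then show ?thesis using that e(2) h1(3) by (metis dist_commute mem_ball subsetD)
  qed
  \<comment> \<open>Halving makes \<open>r < d\<close> strict, so that even the boundary of the ball
    of radius \<open>r\<close> goes into \<open>U\<close>; the bound 1 keeps this ball in the domain
    of \<open>h\<close>.\<close>
  define r where "r = min 1 (d / 2)"
  have r: "0 < r" "r \<le> 1" "r < d" using d(1) by (auto simp: r_def)
  have norm_scale: "norm (r *\<^sub>R z) \<le> r" if "z \<in> cball 0 1" for z :: plane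
    using that r by (simp add: mult_left_le)
  have in_cball: "r *\<^sub>R z \<in> cball 0 1" if "z \<in> cball 0 1" for z :: plane
    using norm_scale[OF that] r unfolding mem_cball dist_0_norm by linarith
  define h' where "h' z = h (r *\<^sub>R z)" for z
  have sub: "h' ` strand i \<subseteq> h ` strand i" for i
  proof -
    have "r *\<^sub>R z \<in> strand i" if "z \<in> strand i" for z
    proof -
      have "\<bar>r * c\<bar> \<le> 1" if "\<bar>c\<bar> \<le> 1" for c :: real
        using that r by (simp add: abs_mult mult_le_one)
      then show ?thesis using that exhaust_2[of i] by (auto simp: mem_strand)
    qed
    then show ?thesis by (auto simp: h'_def)
  qed
  have scale_strand: "h w \<in> h' ` strand i" if "w \<in> strand i" "norm w \<le> r" for w i
  proof -
    have "norm ((1 / r) *\<^sub>R w) \<le> 1" using that r by (simp add: divide_le_eq)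
    then have "\<bar>((1 / r) *\<^sub>R w) $ j\<bar> \<le> 1" for j by (meson component_le_norm_cart order_trans)
    then have "(1 / r) *\<^sub>R w \<in> strand i" using that(1) exhaust_2[of i] by (auto simp: mem_strand)
    moreover have "h' ((1 / r) *\<^sub>R w) = h w" using r by (simp add: h'_def)
    ultimately show ?thesis by (metis imageI)
  qed
  have near: "\<forall>\<^sub>F z in at p within source D. param D z \<in> h' ` strand i"
    if p: "p \<in> preimages D x" and ev: "\<forall>\<^sub>F z in at p within source D. param D z \<in> h ` strand i" for p i
  proof -
    have ps: "p \<in> source D" "param D p = x" using p by (auto simp: preimages_def)
    \<comment> \<open>The image of the outer annulus is compact and misses \<open>x\<close>. By
      continuity the curve avoids it near \<open>p\<close>, so its points on the old strand come
      from vectors of norm at most \<open>r\<close>.\<close>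
    let ?R = "h ` (cball 0 1 - ball 0 r)"
    have "compact ?R"
      by (intro compact_continuous_image continuous_on_subset[OF h1(1)] compact_diff) auto
    then have "open (- ?R)" by (intro open_Compl compact_imp_closed)
    moreover have "x \<notin> ?R"
    proof
      assume "x \<in> ?R"
      then obtain w where w: "w \<in> cball 0 1" "\<not> norm w < r" "h 0 = h w" using h1(3) by auto
      have "0 = w" using inj_onD[OF h1(2) w(3) _ w(1)] by simp
      then show False using w(2) r by simp
    qed
    moreover have "(param D \<longlongrightarrow> x) (at p within source D)"
      using D ps unfolding continuous_on_def by auto
    ultimately have "\<forall>\<^sub>F z in at p within source D. param D z \<in> - ?R"
      by (metis topological_tendstoD ComplI)
    then show ?thesis using ev
    proof eventually_elim
      case (elim z)
      then obtain w where w: "w \<in> strand i" "param D z = h w" by blast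
      then have "norm w \<le> r" using elim(1) strand_subset[of i] by (force simp: not_less)
      then show ?case using scale_strand w by simp
    qed
  qed
  have "crossing_disk D x h'"
    unfolding crossing_disk_def
  proof (intro conjI)
    show "continuous_on (cball 0 1) h'"
      unfolding h'_def using in_cball
      by (intro continuous_on_compose2[OF h1(1)] continuous_intros) auto
    show "inj_on h' (cball 0 1)"
    proof (rule inj_onI)
      fix a b :: plane assume ab: "a \<in> cball 0 1" "b \<in> cball 0 1" "h' a = h' b"
      then have "r *\<^sub>R a = r *\<^sub>R b" using h1(2) in_cball unfolding h'_def by (meson inj_onD)
      then show "a = b" using r by simp
    qed
    show "h' 0 = x" by (simp add: h'_def h1(3))
    show "projection D \<inter> h' ` cball 0 1 = h' ` (strand 1 \<union> strand 2)"
    proof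
      show "h' ` (strand 1 \<union> strand 2) \<subseteq> projection D \<inter> h' ` cball 0 1"
        using sub[of 1] sub[of 2] h1(4) strand_subset[of 1] strand_subset[of 2] by blast
      show "projection D \<inter> h' ` cball 0 1 \<subseteq> h' ` (strand 1 \<union> strand 2)"
      proof
        fix y assume y: "y \<in> projection D \<inter> h' ` cball 0 1"
        then obtain z where z: "z \<in> cball 0 1" "y = h (r *\<^sub>R z)" by (auto simp: h'_def)
        then have "y \<in> h ` (strand 1 \<union> strand 2)" using y h1(4) in_cball by blast
        then obtain w i where w: "w \<in> strand i" "y = h w" by blast
        then have "r *\<^sub>R z = w"
          using z in_cball strand_subset[of i] h1(2) by (metis inj_onD subsetD)
        then have "norm w \<le> r" using norm_scale[OF z(1)] by simp
        then have "y \<in> h' ` strand i" using scale_strand w by simp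
        then show "y \<in> h' ` (strand 1 \<union> strand 2)" using exhaust_2[of i] by auto
      qed
    qed
    have "\<forall>\<^sub>F z in at p within source D. param D z \<in> h' ` strand 1"
      by (rule near) (use pq in auto)
    moreover have "\<forall>\<^sub>F z in at q within source D. param D z \<in> h' ` strand 2"
      by (rule near) (use pq in auto)
    ultimately show "\<exists>p q. preimages D x = {p, q} \<and>
        (\<forall>\<^sub>F z in at p within source D. param D z \<in> h' ` strand 1) \<and>
        (\<forall>\<^sub>F z in at q within source D. param D z \<in> h' ` strand 2)"
      using pq(1) by blast
  qed
  moreover have "h' ` cball 0 1 \<subseteq> U"
  proof
    fix y assume "y \<in> h' ` cball 0 1"
    then obtain z where z: "z \<in> cball 0 1" "y = h (r *\<^sub>R z)" by (auto simp: h'_def)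
    then have "dist (r *\<^sub>R z) 0 < d" using norm_scale[OF z(1)] r unfolding dist_norm diff_zero by linarith
    then show "y \<in> U" using d(2)[OF in_cball[OF z(1)]] unfolding z(2) by blast
  qed
  ultimately show ?thesis by (rule that)
qed

text \<open>Every disk is shrunk into a ball of half the distance to the nearest other point of the
  finite set of crossings and points of \<open>W\<close>. Avoiding \<open>W\<close> will ensure that
  a disk contains no vertices besides its ports.\<close>

lemma smoothing_disks_exist:
  assumes D: "link_diagram D" and W: "finite W" "W \<inter> crossings D = {}"
  obtains h where "smoothing_disks D h" "\<And>x. x \<in> crossings D \<Longrightarrow> h x ` cball 0 1 \<inter> W = {}"
proof -
  let ?X = "crossings D"
  have "\<exists>d>0. \<forall>y\<in>?X \<union> W. y \<noteq> x \<longrightarrow> d \<le> dist x y" for x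
    using D W by (intro finite_set_avoid) (auto simp: link_diagram_def)
  then obtain d where d: "\<And>x. d x > 0" "\<And>x y. y \<in> ?X \<union> W \<Longrightarrow> y \<noteq> x \<Longrightarrow> d x \<le> dist x y"
    by metis
  have "\<exists>h. crossing_disk D x h \<and> h ` cball 0 1 \<subseteq> ball x (d x / 2)" if x: "x \<in> ?X" for x
  proof -
    obtain h0 where "crossing_disk D x h0" using D x unfolding link_diagram_def by blast
    then show ?thesis
      using crossing_disk_shrink[of D x h0 "ball x (d x / 2)"] D d(1)[of x]
      unfolding link_diagram_def by (metis centre_in_ball half_gt_zero open_ball)
  qed
  then obtain h where h: "\<And>x. x \<in> ?X \<Longrightarrow> crossing_disk D x (h x)"
      "\<And>x. x \<in> ?X \<Longrightarrow> h x ` cball 0 1 \<subseteq> ball x (d x / 2)"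
    by metis
  have "disjnt (h x ` cball 0 1) (h y ` cball 0 1)" if "x \<in> ?X" "y \<in> ?X" "x \<noteq> y" for x y
  proof -
    have "ball x (d x / 2) \<inter> ball y (d y / 2) = {}"
    proof (rule ccontr)
      assume "ball x (d x / 2) \<inter> ball y (d y / 2) \<noteq> {}"
      then obtain z where "dist x z < d x / 2" "dist y z < d y / 2" by auto
      then have "dist x y < (d x + d y) / 2"
        using dist_triangle2[of x y z] by (simp add: field_simps)
      moreover have "d x \<le> dist x y" "d y \<le> dist x y"
        using d(2)[of y x] d(2)[of x y] that by (auto simp: dist_commute)
      ultimately show False by simp
    qed
    then show ?thesis using h(2)[OF that(1)] h(2)[OF that(2)] unfolding disjnt_def by blast
  qed
  then have "smoothing_disks D h"
    unfolding smoothing_disks_def pairwise_def using h(1) by blast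
  moreover have "h x ` cball 0 1 \<inter> W = {}" if "x \<in> ?X" for x
  proof -
    have "w \<notin> ball x (d x / 2)" if "w \<in> W" for w
    proof -
      have "w \<noteq> x" using that \<open>x \<in> ?X\<close> W(2) by blast
      then show ?thesis using d(2)[of w x] d(1)[of x] that by auto
    qed
    then show ?thesis using h(2)[OF that] by blast
  qed
  ultimately show ?thesis by (rule that)
qed

section \<open>Subdividing the circles of the source\<close>

lemma circle_arc_system:
  assumes "finite B"
  obtains W \<A> where "arc_system W \<A>" "\<Union>\<A> = sphere (0::complex) 1" "W \<subseteq> sphere 0 1" "finite W" "W \<inter> B = {}"
proof -
  have loop: "loop_image (sphere (0::complex) 1)"
    unfolding loop_image_def
    by (intro exI[of _ "circlepath 0 1"]) (auto simp: simple_path_circlepath path_image_circlepath)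
  have "infinite (sphere (0::complex) 1)"
  proof
    assume "finite (sphere (0::complex) 1)"
    moreover have "connected (sphere (0::complex) 1)" by (intro connected_sphere) simp
    ultimately obtain z where "sphere (0::complex) 1 = {z}"
      by (metis connected_finite_iff_sing sphere_eq_empty zero_le_one not_le)
    moreover have "1 \<in> sphere (0::complex) 1" "- 1 \<in> sphere (0::complex) 1" by auto
    ultimately have "(1::complex) = - 1" by (metis singletonD)
    then show False by simp
  qed
  then have inf: "infinite (sphere (0::complex) 1 - F)" if "finite F" for F using that by simp
  \<comment> \<open>Edges are arcs with distinct ends, so the circle is cut at two points; the
    finite set \<open>B\<close> cannot exhaust it.\<close>
  obtain a where a: "a \<in> sphere 0 1 - B" using inf[OF assms] by (metis ex_in_conv finite.emptyI)
  obtain b where b: "b \<in> sphere 0 1 - insert a B" using inf[of "insert a B"] assms by (metis ex_in_conv finite.emptyI finite.insertI)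
  obtain S T where "arc_between S a b" "arc_between T b a" "S \<inter> T = {a, b}" "S \<union> T = sphere 0 1"
    using loop_image_split[OF loop, of a b] a b by blast
  then show ?thesis
    using a b by (intro that[OF arc_system_two_arcs[of S a b T]]) auto
qed

lemma arc_system_homeomorphic_image:
  assumes A: "arc_system V \<A>" and f: "continuous_on (\<Union>\<A>) f" "inj_on f (\<Union>\<A>)" and V: "V \<subseteq> \<Union>\<A>"
  shows "arc_system (f ` V) ((`) f ` \<A>)"
  unfolding arc_system_def
proof (intro conjI ballI impI)
  note sys = arc_systemD[OF A]
  have inter: "f ` a \<inter> f ` b = f ` (a \<inter> b)" if "a \<subseteq> \<Union>\<A>" "b \<subseteq> \<Union>\<A>" for a b
    using inj_on_image_Int[OF f(2) that] by simp
  show "finite ((`) f ` \<A>)" using sys(1) by simp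
  show "\<exists>u v. arc_between b u v \<and> b \<inter> f ` V = {u, v}" if b: "b \<in> (`) f ` \<A>" for b
  proof -
    obtain a where a: "a \<in> \<A>" "b = f ` a" using b by blast
    obtain u v where uv: "arc_between a u v" "a \<inter> V = {u, v}" using sys(2)[OF a(1)] by blast
    have "arc_between b (f u) (f v)"
      unfolding a(2) using a(1) f by (intro arc_between_continuous_image[OF uv(1)])
        (auto intro: continuous_on_subset inj_on_subset)
    moreover have "b \<inter> f ` V = {f u, f v}"
      using inter[of a V] a V uv(2) by auto
    ultimately show ?thesis by blast
  qed
  show "b \<inter> b' \<subseteq> f ` V" if b: "b \<in> (`) f ` \<A>" "b' \<in> (`) f ` \<A>" "b \<noteq> b'" for b b'
  proof -
    obtain a a' where a: "a \<in> \<A>" "b = f ` a" "a' \<in> \<A>" "b' = f ` a'" using b(1,2) by blast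
    then have "b \<inter> b' = f ` (a \<inter> a')" using inter[of a a'] by blast
    moreover have "a \<inter> a' \<subseteq> V" using a b(3) by (intro sys(3)) auto
    ultimately show ?thesis by blast
  qed
  show "card {b \<in> (`) f ` \<A>. v \<in> b} = 2" if v: "v \<in> f ` V" for v
  proof -
    obtain w where w: "w \<in> V" "v = f w" using v by blast
    have mem: "f w \<in> f ` a \<longleftrightarrow> w \<in> a" if "a \<in> \<A>" for a
      using f(2) w(1) V that by (meson Union_upper inj_on_image_mem_iff subsetD)
    then have "{b \<in> (`) f ` \<A>. v \<in> b} = (`) f ` {a \<in> \<A>. w \<in> a}" using w(2) by auto
    moreover have "inj_on ((`) f) {a \<in> \<A>. w \<in> a}"
      by (rule inj_on_image) (use f(2) in \<open>auto intro: inj_on_subset\<close>)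
    ultimately show ?thesis using sys(4)[OF w(1)] by (simp add: card_image)
  qed
qed

text \<open>Induction on the number of circles, cutting each at two points. The set \<open>B\<close>
  will consist of the preimages of crossings, so that the initial vertices stay clear of all
  crossings.\<close>

lemma source_arc_system:
  assumes "finite B"
  obtains W \<A> where "arc_system W \<A>" "\<Union>\<A> = source D" "W \<subseteq> source D" "finite W" "W \<inter> B = {}"
proof -
  have "\<exists>W \<A>. arc_system W \<A> \<and> \<Union>\<A> = {..<n} \<times> sphere (0::complex) 1 \<and> W \<subseteq> {..<n} \<times> sphere 0 1 \<and> finite W \<and> W \<inter> B = {}"
    for n :: nat
  proof (induction n)
    case 0
    show ?case by (intro exI[of _ "{}"]) (auto simp: arc_system_def)
  next
    case (Suc n)
    then obtain W \<A> where W: "arc_system W \<A>" "\<Union>\<A> = {..<n} \<times> sphere (0::complex) 1"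
      "W \<subseteq> {..<n} \<times> sphere 0 1" "finite W" "W \<inter> B = {}" by metis
    \<comment> \<open>Avoiding the second coordinates of \<open>B\<close> keeps the new vertices off
      \<open>B\<close> whatever the index of the circle.\<close>
    obtain W' \<A>' where W': "arc_system W' \<A>'" "\<Union>\<A>' = sphere (0::complex) 1" "W' \<subseteq> sphere 0 1" "finite W'"
      "W' \<inter> snd ` B = {}"
      using circle_arc_system[of "snd ` B"] assms by blast
    let ?W = "Pair n ` W'" and ?A = "(`) (Pair n) ` \<A>'"
    have "arc_system ?W ?A"
      using W' by (intro arc_system_homeomorphic_image[OF W'(1)] continuous_intros) (auto simp: inj_on_def)
    moreover have A: "\<Union>?A = {n} \<times> sphere 0 1" using W'(2) by (auto simp flip: image_Union)
    ultimately have "arc_system (W \<union> ?W) (\<A> \<union> ?A)"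
      using W W'(3) by (intro arc_system_Un) auto
    moreover have "\<Union>(\<A> \<union> ?A) = {..<Suc n} \<times> sphere 0 1"
      unfolding Union_Un_distrib A W(2) by auto
    moreover have "W \<union> ?W \<subseteq> {..<Suc n} \<times> sphere 0 1" using W(3) W'(3) by auto
    moreover have "(W \<union> ?W) \<inter> B = {}" using W(5) W'(5) by force
    ultimately show ?case using W(4) W'(4) by (intro exI[of _ "W \<union> ?W"] exI[of _ "\<A> \<union> ?A"]) auto
  qed
  then show ?thesis using that unfolding source_def by metis
qed

section \<open>Lifting the strands of a crossing to the source\<close>

lemma inj_off_crossings:
  assumes "link_diagram D"
  shows "inj_on (param D) {z \<in> source D. param D z \<notin> crossings D}"
proof (rule inj_onI)
  fix z z'
  assume z: "z \<in> {z \<in> source D. param D z \<notin> crossings D}" "z' \<in> {z \<in> source D. param D z \<notin> crossings D}"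
    "param D z = param D z'"
  then have "{z, z'} \<subseteq> preimages D (param D z)" by (auto simp: preimages_def)
  moreover have "card (preimages D (param D z)) \<noteq> 2" "finite (preimages D (param D z))"
    "card (preimages D (param D z)) \<le> 2"
    using z(1) assms by (auto simp: crossings_def link_diagram_def)
  ultimately have "card {z, z'} < 2"
    using card_mono[of "preimages D (param D z)" "{z, z'}"] by linarith
  then show "z = z'" by (cases "z = z'") auto
qed

text \<open>Since \<open>x\<close> is the only crossing in the disk, two points with equal image can
  only be \<open>p\<close> and \<open>q\<close>, and one of these is removed.\<close>

lemma inj_strand_lift:
  assumes link: "link_diagram D" and only: "crossings D \<inter> h ` cball 0 1 \<subseteq> {x}"
    and pq: "preimages D x = {p, q}" "r \<in> {p, q}"
  shows "inj_on (param D) ({z \<in> source D. param D z \<in> h ` strand i} - {r})"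
proof (rule inj_onI)
  let ?T = "{z \<in> source D. param D z \<in> h ` strand i} - {r}"
  fix z z' assume z: "z \<in> ?T" "z' \<in> ?T" "param D z = param D z'"
  show "z = z'"
  proof (cases "param D z = x")
    case True
    then have "{z, z'} \<subseteq> {p, q} - {r}" using z pq(1) by (auto simp: preimages_def)
    then show ?thesis using pq(2) by auto
  next
    case False
    then have "param D z \<notin> crossings D" using only z(1) strand_subset[of i] by auto
    then show ?thesis using inj_onD[OF inj_off_crossings[OF link] z(3)] z by auto
  qed
qed

text \<open>With \<open>q\<close>, the preimage of \<open>x\<close> on the other strand, removed,
  \<open>param D\<close> maps \<open>T\<close> bijectively onto the strand. Once \<open>T\<close> is
  known to be compact this is a homeomorphism, and its inverse carries the strand back to an arc in
  the source.\<close>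

lemma strand_lift:
  assumes link: "link_diagram D" and disk: "crossing_disk D x h"
    and only: "crossings D \<inter> h ` cball 0 1 \<subseteq> {x}"
    and "i \<noteq> j" and pq: "preimages D x = {p, q}" "p \<noteq> q"
    and near: "\<forall>\<^sub>F z in at q within source D. param D z \<in> h ` strand j"
  defines "T \<equiv> {z \<in> source D. param D z \<in> h ` strand i} - {q}"
  shows "\<exists>u v. arc_between T u v \<and> param D u = h (- axis i 1) \<and> param D v = h (axis i 1)"
proof -
  let ?f = "param D"
  have cont: "continuous_on (source D) ?f" using link unfolding link_diagram_def by blast
  have h: "continuous_on (cball 0 1) h" "inj_on h (cball 0 1)" "h 0 = x"
    "projection D \<inter> h ` cball 0 1 = h ` (strand 1 \<union> strand 2)"
    using disk unfolding crossing_disk_def by auto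
  have pqs: "p \<in> source D" "q \<in> source D" "?f p = x" "?f q = x"
    using pq(1) unfolding preimages_def by auto
  have x_strand: "x \<in> h ` strand k" for k
    using h(3) strand_Int_strand exhaust_2[of k] by blast
  have strands: "h ` strand i \<inter> h ` strand j \<subseteq> {x}"
  proof -
    have "h ` strand i \<inter> h ` strand j = h ` (strand i \<inter> strand j)"
      using inj_on_image_Int[OF h(2) strand_subset strand_subset] by simp
    also have "strand i \<inter> strand j = {0}"
      using \<open>i \<noteq> j\<close> exhaust_2[of i] exhaust_2[of j] strand_Int_strand by (auto simp: Int_commute)
    finally show ?thesis using h(3) by simp
  qed
  have inj: "inj_on ?f T"
    unfolding T_def using inj_strand_lift[OF link only pq(1)] by simp
  have surj: "?f ` T = h ` strand i"
  proof
    show "?f ` T \<subseteq> h ` strand i" by (auto simp: T_def)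
    show "h ` strand i \<subseteq> ?f ` T"
    proof
      fix y assume y: "y \<in> h ` strand i"
      then have "y \<in> projection D" using h(4) exhaust_2[of i] by auto
      then obtain z where z: "z \<in> source D" "?f z = y" by (auto simp: projection_def)
      show "y \<in> ?f ` T"
      proof (cases "z = q")
        case True
        then have "y = ?f p" using z pqs by simp
        moreover have "p \<in> T" using pqs pq(2) x_strand by (simp add: T_def)
        ultimately show ?thesis by blast
      next
        case False
        then show ?thesis using z y by (auto simp: T_def)
      qed
    qed
  qed
  have "compact T"
  proof -
    obtain N where N: "open N" "q \<in> N" "\<And>z. z \<in> N \<Longrightarrow> z \<noteq> q \<Longrightarrow> z \<in> source D \<Longrightarrow> ?f z \<in> h ` strand j"
      using near unfolding eventually_at_topological by metis
    \<comment> \<open>Transversality at work: near \<open>q\<close> the curve runs on strand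
      \<open>j\<close>, which meets strand \<open>i\<close> only in \<open>x\<close>, so
      \<open>q\<close> is isolated in the preimage of strand \<open>i\<close> and its removal leaves
      a closed set. The neighbourhood \<open>N\<close> may contain \<open>p\<close>, which has to
      stay in \<open>T\<close>.\<close>
    have "T = source D \<inter> ((source D \<inter> ?f -` (h ` strand i)) \<inter> - (N - {p}))"
    proof -
      have "z \<notin> N - {p}" if "z \<in> T" for z
      proof
        assume "z \<in> N - {p}"
        then have "?f z = x" using N(3)[of z] that strands unfolding T_def by blast
        then have "z \<in> {p, q}" using that pq(1) unfolding T_def preimages_def by blast
        then show False using \<open>z \<in> N - {p}\<close> that unfolding T_def by blast
      qed
      then show ?thesis using N(2) pq(2) unfolding T_def by blast
    qed
    moreover have "closed (source D \<inter> ?f -` (h ` strand i))"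
    proof (rule continuous_closed_preimage[OF cont])
      show "closed (source D)" by (simp add: compact_imp_closed compact_source)
      show "closed (h ` strand i)"
        by (intro compact_imp_closed compact_continuous_image continuous_on_subset[OF h(1) strand_subset])
          (simp add: strand_def)
    qed
    moreover have "closed (- (N - {p}))" using N(1) by (simp add: open_delete closed_Compl)
    ultimately show ?thesis
      using compact_Int_closed[OF compact_source] by (metis closed_Int)
  qed
  moreover have "continuous_on T ?f" by (rule continuous_on_subset[OF cont]) (auto simp: T_def)
  ultimately obtain k where k: "homeomorphism T (h ` strand i) ?f k"
    using homeomorphism_compact[OF _ _ surj inj] by blast
  have "arc_between (strand i) (- axis i 1) (axis i 1)"
    unfolding strand_def by (rule arc_between_segment) (simp add: vec_eq_iff axis_def)
  then have "arc_between (h ` strand i) (h (- axis i 1)) (h (axis i 1))"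
    by (rule arc_between_continuous_image)
      (use h(1,2) strand_subset[of i] in \<open>auto intro: continuous_on_subset inj_on_subset\<close>)
  then have "arc_between (k ` h ` strand i) (k (h (- axis i 1))) (k (h (axis i 1)))"
    by (rule arc_between_continuous_image)
      (use k in \<open>auto simp: homeomorphism_def intro: inj_on_inverseI[where g = ?f]\<close>)
  moreover have "k ` h ` strand i = T" using k by (simp add: homeomorphism_def)
  moreover have "?f (k (h v)) = h v" if "v \<in> {- axis i 1, axis i 1}" for v
    using that k by (intro homeomorphism_apply2[OF k]) (auto simp: strand_def)
  ultimately show ?thesis by blast
qed


subsection \<open>Cutting a diagram at its crossings\<close>

text \<open>The graph lives in the source, where a crossing is two separate points and every vertex
  has degree two. \<open>V_disk\<close> requires the vertices over a disk to be exactly the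
  preimages of its ports, so each lifted strand becomes one undivided edge.\<close>

locale cut_diagram =
  fixes D :: diagram and h :: "plane \<Rightarrow> plane \<Rightarrow> plane" and V :: "(nat \<times> complex) set"
    and \<B> :: "(nat \<times> complex) set set"
  assumes link: "link_diagram D" and disks: "smoothing_disks D h"
    and system: "arc_system V \<B>" and cover: "\<Union>\<B> = source D" and V_source: "V \<subseteq> source D"
    and V_disk: "\<And>x z. x \<in> crossings D \<Longrightarrow> z \<in> source D \<Longrightarrow> param D z \<in> h x ` cball 0 1 \<Longrightarrow>
                   z \<in> V \<longleftrightarrow> param D z \<in> h x ` ports"
begin

abbreviation f :: "nat \<times> complex \<Rightarrow> plane" where "f \<equiv> param D"
abbreviation X :: "plane set" where "X \<equiv> crossings D"

definition nbhd :: "plane \<Rightarrow> plane set" where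
  "nbhd x = h x ` cball 0 1"

definition port_set :: "plane \<Rightarrow> plane set" where
  "port_set x = h x ` ports"

definition cross :: "plane \<Rightarrow> plane set" where
  "cross x = h x ` (strand 1 \<union> strand 2)"

lemma disk:
  assumes "x \<in> X"
  shows "crossing_disk D x (h x)" "continuous_on (cball 0 1) (h x)" "inj_on (h x) (cball 0 1)" "h x 0 = x"
    "projection D \<inter> nbhd x = cross x"
proof -
  have "crossing_disk D x (h x)" using disks assms unfolding smoothing_disks_def by blast
  then show "crossing_disk D x (h x)" "continuous_on (cball 0 1) (h x)" "inj_on (h x) (cball 0 1)" "h x 0 = x"
    "projection D \<inter> nbhd x = cross x"
    by (simp_all add: crossing_disk_def nbhd_def cross_def)
qed

lemma vertex_iff: "x \<in> X \<Longrightarrow> z \<in> source D \<Longrightarrow> f z \<in> nbhd x \<Longrightarrow> z \<in> V \<longleftrightarrow> f z \<in> port_set x"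
  using V_disk unfolding nbhd_def port_set_def .

lemma disk_unique:
  assumes "x \<in> X" "y \<in> X" "z \<in> nbhd x" "z \<in> nbhd y"
  shows "x = y"
proof (rule ccontr)
  assume "x \<noteq> y"
  then have "disjnt (nbhd x) (nbhd y)"
    using disks assms(1,2) unfolding smoothing_disks_def pairwise_def nbhd_def by simp
  then show False using assms(3,4) unfolding disjnt_iff by blast
qed

lemma crossing_in_disk: "x \<in> X \<Longrightarrow> x \<in> nbhd x"
  unfolding nbhd_def using disk(4)[of x] by (intro image_eqI[of _ _ 0]) auto

lemma image_nbhd: "A \<subseteq> cball 0 1 \<Longrightarrow> h x ` A \<subseteq> nbhd x"
  unfolding nbhd_def by (rule image_mono)

lemma strand_nbhd: "h x ` strand i \<subseteq> nbhd x"
  by (rule image_nbhd[OF strand_subset])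

lemma cross_nbhd: "cross x \<subseteq> nbhd x"
  unfolding cross_def by (intro image_nbhd Un_least strand_subset)

lemma disk_Int:
  assumes "x \<in> X" "A \<subseteq> cball 0 1" "B \<subseteq> cball 0 1"
  shows "h x ` A \<inter> h x ` B = h x ` (A \<inter> B)"
  using inj_on_image_Int[OF disk(3)[OF assms(1)] assms(2,3)] by simp

lemma ports_cball: "ports \<subseteq> cball 0 1"
  by (rule order_trans[OF ports_subset Un_least[OF strand_subset strand_subset]])

lemma port_set_cross: "port_set x \<subseteq> cross x"
  unfolding port_set_def cross_def by (rule image_mono[OF ports_subset])

lemma port_set_nbhd: "port_set x \<subseteq> nbhd x"
  using port_set_cross cross_nbhd by (rule order_trans)

text \<open>The lifted strands have vertices at their ends only, so \<open>arc_system_member\<close>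
  identifies them as edges. Together they make up all of the source over the disk.\<close>

lemma strand_arcs:
  assumes x: "x \<in> X"
  obtains T1 T2 where "T1 \<in> \<B>" "T2 \<in> \<B>" "T1 \<union> T2 = {z \<in> source D. f z \<in> nbhd x}" "T1 \<inter> T2 = {}"
proof -
  obtain p q where pq: "preimages D x = {p, q}"
    "\<forall>\<^sub>F z in at p within source D. f z \<in> h x ` strand 1"
    "\<forall>\<^sub>F z in at q within source D. f z \<in> h x ` strand 2"
    using disk(1)[OF x] unfolding crossing_disk_def by auto
  have "card (preimages D x) = 2" using x by (simp add: crossings_def)
  then have "p \<noteq> q" unfolding pq(1) by auto
  have only: "X \<inter> nbhd x \<subseteq> {x}"
    using disk_unique[OF _ x crossing_in_disk] by auto
  \<comment> \<open>The point \<open>r\<close> to be removed is the preimage of \<open>x\<close> on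
    the other strand: \<open>q\<close> for strand 1 and \<open>p\<close> for strand 2.\<close>
  define T where "T i r = {z \<in> source D. f z \<in> h x ` strand i} - {r}" for i r
  have member: "T i r \<in> \<B>"
    if ends: "\<exists>u v. arc_between (T i r) u v \<and> f u = h x (- axis i 1) \<and> f v = h x (axis i 1)"
      and inj: "inj_on f (T i r)" for i r
  proof -
    obtain u v where uv: "arc_between (T i r) u v" "f u = h x (- axis i 1)" "f v = h x (axis i 1)"
      using ends by blast
    have uvT: "u \<in> T i r" "v \<in> T i r" using arc_between_ends[OF uv(1)] by auto
    have "z \<in> V \<longleftrightarrow> z \<in> {u, v}" if z: "z \<in> T i r" for z
    proof -
      have fz: "z \<in> source D" "f z \<in> h x ` strand i" using z by (auto simp: T_def)
      then have "z \<in> V \<longleftrightarrow> f z \<in> h x ` strand i \<inter> port_set x"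
        using vertex_iff[OF x fz(1)] strand_nbhd[of x i] by auto
      also have "h x ` strand i \<inter> port_set x = {f u, f v}"
        unfolding port_set_def disk_Int[OF x strand_subset ports_cball] strand_Int_ports using uv by auto
      also have "f z \<in> {f u, f v} \<longleftrightarrow> z \<in> {u, v}"
        using inj z uvT by (auto dest: inj_onD)
      finally show ?thesis .
    qed
    then have "T i r \<inter> V = {u, v}" using uvT by blast
    moreover have "T i r \<subseteq> \<Union>\<B>" unfolding cover T_def by blast
    ultimately show ?thesis using arc_system_member[OF system uv(1)] by blast
  qed
  have inj: "inj_on f (T i r)" if "r \<in> {p, q}" for i r
    unfolding T_def using inj_strand_lift[OF link only[unfolded nbhd_def] pq(1) that] .
  have T1: "T 1 q \<in> \<B>"
    using strand_lift[OF link disk(1)[OF x] only[unfolded nbhd_def] _ pq(1) \<open>p \<noteq> q\<close> pq(3), of 1]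
    by (intro member inj) (auto simp: T_def)
  have "preimages D x = {q, p}" using pq(1) by auto
  then have T2: "T 2 p \<in> \<B>"
    using strand_lift[OF link disk(1)[OF x] only[unfolded nbhd_def] _ _ \<open>p \<noteq> q\<close>[symmetric] pq(2), of 2]
    by (intro member inj) (auto simp: T_def)
  have pre_x: "z \<in> {p, q}" if "z \<in> source D" "f z = x" for z
    using that pq(1) by (auto simp: preimages_def)
  have pqs: "p \<in> source D" "q \<in> source D" "f p = x" "f q = x"
    using pq(1) unfolding preimages_def by auto
  have "h x ` strand 1 \<inter> h x ` strand 2 = {x}"
    unfolding disk_Int[OF x strand_subset strand_subset] strand_Int_strand using disk(4)[OF x] by simp
  \<comment> \<open>A common point would lie over \<open>x\<close>, hence be \<open>p\<close> or
    \<open>q\<close>, but each of these is missing from one of the lifts.\<close>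
  then have "T 1 q \<inter> T 2 p = {}" using pre_x unfolding T_def by blast
  moreover have "T 1 q \<union> T 2 p = {z \<in> source D. f z \<in> nbhd x}"
  proof -
    have "f z \<in> nbhd x \<longleftrightarrow> f z \<in> h x ` strand 1 \<union> h x ` strand 2" if "z \<in> source D" for z
      using that disk(5)[OF x] cross_nbhd[of x] unfolding projection_def cross_def image_Un by auto
    moreover have "p \<in> T 1 q" "q \<in> T 2 p"
      using pqs \<open>p \<noteq> q\<close> \<open>h x ` strand 1 \<inter> h x ` strand 2 = {x}\<close> unfolding T_def by auto
    ultimately show ?thesis unfolding T_def by blast
  qed
  ultimately show ?thesis using that[OF T1 T2] by simp
qed

text \<open>These are the arcs of the diagram that survive every smoothing; they may touch a disk,
  but only at its ports.\<close>

definition outer :: "(nat \<times> complex) set set" where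
  "outer = {a \<in> \<B>. \<forall>x\<in>X. \<not> f ` a \<subseteq> nbhd x}"

text \<open>An edge over the disk that differs from both lifts would meet them only in vertices and
  so consist of vertices, yet an arc has interior points.\<close>

lemma outer_iff:
  assumes "x \<in> X" "T1 \<in> \<B>" "T2 \<in> \<B>" "T1 \<union> T2 = {z \<in> source D. f z \<in> nbhd x}" "a \<in> \<B>"
  shows "f ` a \<subseteq> nbhd x \<longleftrightarrow> a = T1 \<or> a = T2"
proof
  assume "f ` a \<subseteq> nbhd x"
  then have "a \<subseteq> T1 \<union> T2" unfolding assms(4) using assms(5) cover by blast
  show "a = T1 \<or> a = T2"
  proof (rule ccontr)
    assume "\<not> (a = T1 \<or> a = T2)"
    then have "a \<inter> T1 \<subseteq> V" "a \<inter> T2 \<subseteq> V"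
      using arc_systemD(3)[OF system assms(5)] assms(2,3) by auto
    then have "a \<subseteq> V" using \<open>a \<subseteq> T1 \<union> T2\<close> by blast
    moreover obtain u v where "arc_between a u v" "a \<inter> V = {u, v}"
      using arc_systemD(2)[OF system assms(5)] by blast
    ultimately show False using arc_between_interior(2) by blast
  qed
next
  assume "a = T1 \<or> a = T2"
  then show "f ` a \<subseteq> nbhd x" using assms(4) by blast
qed

lemma outer_disk:
  assumes "a \<in> outer" "z \<in> a" "x \<in> X" "f z \<in> nbhd x"
  shows "z \<in> V"
proof -
  obtain T1 T2 where T: "T1 \<in> \<B>" "T2 \<in> \<B>" "T1 \<union> T2 = {z \<in> source D. f z \<in> nbhd x}"
    and "T1 \<inter> T2 = {}"
    by (rule strand_arcs[OF assms(3)])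
  have a: "a \<in> \<B>" "a \<noteq> T1" "a \<noteq> T2"
  proof -
    show "a \<in> \<B>" using assms(1) unfolding outer_def by simp
    moreover have "\<not> f ` a \<subseteq> nbhd x" using assms(1,3) unfolding outer_def by simp
    ultimately show "a \<noteq> T1" "a \<noteq> T2" using outer_iff[OF assms(3) T] by simp_all
  qed
  have "z \<in> T1 \<union> T2" unfolding T(3) using assms(2,4) a(1) cover by auto
  then show ?thesis
    using arc_systemD(3)[OF system a(1) T(1) a(2)] arc_systemD(3)[OF system a(1) T(2) a(3)] assms(2) by blast
qed

text \<open>The two lifts over the disk are disjoint, so exactly one of the two edges at
  \<open>z\<close> is such a lift, and the other one leaves the disk.\<close>

lemma outer_at_port:
  assumes z: "z \<in> V" and x: "x \<in> X" "f z \<in> nbhd x"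
  shows "\<exists>e. {a \<in> outer. z \<in> a} = {e}"
proof -
  obtain T1 T2 where T: "T1 \<in> \<B>" "T2 \<in> \<B>" "T1 \<union> T2 = {z \<in> source D. f z \<in> nbhd x}"
    and disj: "T1 \<inter> T2 = {}"
    by (rule strand_arcs[OF x(1)])
  obtain T where T': "T \<in> {T1, T2}" "z \<in> T" "\<And>a. a \<in> {T1, T2} \<Longrightarrow> z \<in> a \<Longrightarrow> a = T"
  proof -
    have "z \<in> T1 \<union> T2" unfolding T(3) using z x(2) V_source by auto
    then show thesis using that disj by auto
  qed
  have "T \<in> \<B>" using T'(1) T(1,2) by auto
  then obtain e where e: "e \<noteq> T" "{a \<in> \<B>. z \<in> a} = {T, e}"
    using arc_system_other[OF system _ T'(2) z] by metis
  have inner: "a = T" if a: "a \<in> \<B>" "z \<in> a" "a \<notin> outer" for a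
  proof -
    obtain y where y: "y \<in> X" "f ` a \<subseteq> nbhd y" using a unfolding outer_def by blast
    then have "y = x" using disk_unique[OF y(1) x(1)] a(2) x(2) by blast
    then show ?thesis using outer_iff[OF x(1) T a(1)] y(2) T'(3) a(2) by blast
  qed
  have "T \<notin> outer"
    using outer_iff[OF x(1) T \<open>T \<in> \<B>\<close>] T'(1) x(1) unfolding outer_def by blast
  have "e \<in> \<B>" "z \<in> e" using e(2) by auto
  then have "e \<in> outer" using inner e(1) by auto
  moreover have "a = e" if "a \<in> outer" "z \<in> a" for a
  proof -
    have "a \<in> {a \<in> \<B>. z \<in> a}" using that unfolding outer_def by simp
    then show ?thesis using that(1) \<open>T \<notin> outer\<close> unfolding e(2) by auto
  qed
  ultimately have "{a \<in> outer. z \<in> a} = {e}" using \<open>z \<in> e\<close> by blast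
  then show ?thesis by blast
qed

lemma outer_off_disks:
  assumes "\<forall>x\<in>X. f z \<notin> nbhd x"
  shows "{a \<in> outer. z \<in> a} = {a \<in> \<B>. z \<in> a}"
proof -
  have "a \<in> outer" if "a \<in> \<B>" "z \<in> a" for a using that assms unfolding outer_def image_subset_iff by auto
  moreover have "outer \<subseteq> \<B>" by (auto simp: outer_def)
  ultimately show ?thesis by auto
qed

lemma outer_at_vertex:
  assumes "z \<in> V"
  obtains a where "a \<in> outer" "z \<in> a"
proof (cases "\<exists>x\<in>X. f z \<in> nbhd x")
  case True
  then show ?thesis using outer_at_port[OF assms] that by blast
next
  case False
  then have "card {a \<in> outer. z \<in> a} = 2"
    using outer_off_disks[of z] arc_systemD(4)[OF system assms] by simp
  then have "{a \<in> outer. z \<in> a} \<noteq> {}" by (metis card.empty zero_neq_numeral)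
  then show ?thesis using that by blast
qed

text \<open>A crossing is the centre of its own disk. Vertices and outer edges meet that disk in
  ports only, and the centre is not a port.\<close>

lemma not_crossing:
  assumes "z \<in> V \<or> (\<exists>a\<in>outer. z \<in> a)"
  shows "z \<in> source D" "f z \<notin> X"
proof -
  show zs: "z \<in> source D" using assms V_source cover unfolding outer_def by blast
  show "f z \<notin> X"
  proof
    assume x: "f z \<in> X"
    then have "z \<in> V" using assms outer_disk crossing_in_disk by blast
    then have "f z \<in> port_set (f z)" using vertex_iff[OF x zs] crossing_in_disk[OF x] by blast
    then obtain v where v: "v \<in> ports" "h (f z) v = h (f z) 0"
      using disk(4)[OF x] unfolding port_set_def by auto
    then have "v = 0" using inj_onD[OF disk(3)[OF x] v(2)] ports_cball by auto
    then show False using v(1) by (simp add: mem_ports)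
  qed
qed

section \<open>The planar graph of a smoothed diagram\<close>

lemma inj_outer: "inj_on f {z. z \<in> V \<or> (\<exists>a\<in>outer. z \<in> a)}"
  by (rule inj_on_subset[OF inj_off_crossings[OF link]]) (use not_crossing in blast)

text \<open>This set does not depend on the smoothings, which makes it a common yardstick for
  components of different smoothed diagrams.\<close>

definition edges :: "plane set set" where
  "edges = (`) f ` outer"

definition piece :: "(plane \<Rightarrow> bool) \<Rightarrow> plane \<Rightarrow> bool \<Rightarrow> plane set" where
  "piece \<sigma> x k = h x ` chord (\<sigma> x) k"

definition pieces :: "(plane \<Rightarrow> bool) \<Rightarrow> plane set set" where
  "pieces \<sigma> = {piece \<sigma> x k | x k. x \<in> X}"

lemma piece_disk: "piece \<sigma> x k \<subseteq> nbhd x"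
  unfolding piece_def by (rule image_nbhd[OF chord_subset])

lemma vertices_disk:
  assumes "x \<in> X"
  shows "f ` V \<inter> nbhd x = port_set x"
proof
  show "f ` V \<inter> nbhd x \<subseteq> port_set x" using vertex_iff[OF assms] V_source by blast
  show "port_set x \<subseteq> f ` V \<inter> nbhd x"
  proof
    fix y assume y: "y \<in> port_set x"
    then have "y \<in> projection D" "y \<in> nbhd x"
      using disk(5)[OF assms] port_set_cross port_set_nbhd by blast+
    then obtain z where "z \<in> source D" "f z = y" by (auto simp: projection_def)
    then show "y \<in> f ` V \<inter> nbhd x"
      using vertex_iff[OF assms, of z] y \<open>y \<in> nbhd x\<close> by blast
  qed
qed

lemma edges_disk:
  assumes "e \<in> edges" "y \<in> e" "x \<in> X" "y \<in> nbhd x"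
  shows "y \<in> f ` V" "y \<in> port_set x"
proof -
  obtain a z where "a \<in> outer" "z \<in> a" "y = f z" using assms(1,2) unfolding edges_def by blast
  then show "y \<in> f ` V" using outer_disk assms(3,4) by blast
  then show "y \<in> port_set x" using vertices_disk[OF assms(3)] assms(4) by blast
qed

lemma edges_projection: "e \<in> edges \<Longrightarrow> e \<subseteq> projection D"
  unfolding edges_def outer_def projection_def using cover by auto

text \<open>This keeps chords and edges distinct as sets, so that the numbers of edges and of chords
  at a vertex add up to its degree.\<close>

lemma piece_not_projection:
  assumes "x \<in> X"
  shows "\<not> piece \<sigma> x k \<subseteq> projection D"
proof
  assume "piece \<sigma> x k \<subseteq> projection D"
  then have "piece \<sigma> x k \<subseteq> cross x"
    using disk(5)[OF assms] piece_disk[of \<sigma> x k] by blast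
  then have "chord (\<sigma> x) k \<subseteq> strand 1 \<union> strand 2"
    unfolding piece_def cross_def
    using inj_on_image_subset_iff[OF disk(3)[OF assms] chord_subset Un_least[OF strand_subset strand_subset]]
    by simp
  then show False using chord_not_subset_strands by blast
qed

lemma piece_vertices:
  assumes "x \<in> X"
  shows "piece \<sigma> x k \<inter> f ` V = h x ` (chord (\<sigma> x) k \<inter> ports)"
proof -
  have "piece \<sigma> x k \<inter> f ` V = piece \<sigma> x k \<inter> port_set x"
    using vertices_disk[OF assms] piece_disk[of \<sigma> x k] by blast
  then show ?thesis unfolding piece_def port_set_def using disk_Int[OF assms chord_subset ports_cball] by simp
qed

lemma pieces_disjoint:
  assumes "x \<in> X" "y \<in> X" "(x, k) \<noteq> (y, l)"
  shows "piece \<sigma> x k \<inter> piece \<sigma> y l = {}"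
proof (cases "x = y")
  case True
  have "chord (\<sigma> x) k \<inter> chord (\<sigma> x) l = {}"
    using assms(3) True chord_Int_chord by (cases k; cases l) auto
  then show ?thesis
    unfolding True piece_def using disk_Int[OF assms(2) chord_subset chord_subset] True by simp
next
  case False
  then show ?thesis
    using disk_unique[OF assms(1,2)] piece_disk[of \<sigma> x k] piece_disk[of \<sigma> y l] by blast
qed

lemma piece_arc:
  assumes "x \<in> X"
  obtains a b where "arc_between (piece \<sigma> x k) a b" "piece \<sigma> x k \<inter> f ` V = {a, b}"
proof -
  obtain u v where uv: "arc_between (chord (\<sigma> x) k) u v" "chord (\<sigma> x) k \<inter> ports = {u, v}"
    using chord_ends[of "\<sigma> x" k] by metis
  have "arc_between (piece \<sigma> x k) (h x u) (h x v)"
    unfolding piece_def using disk(2,3)[OF assms] chord_subset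
    by (intro arc_between_continuous_image[OF uv(1)]) (auto intro: continuous_on_subset inj_on_subset)
  moreover have "piece \<sigma> x k \<inter> f ` V = {h x u, h x v}"
    unfolding piece_vertices[OF assms] uv(2) by simp
  ultimately show ?thesis by (rule that)
qed

text \<open>At a port one outer edge meets one chord; a vertex off the disks has two outer edges and
  no chord.\<close>

lemma card_pieces_at:
  assumes w: "w \<in> V"
  shows "card {a \<in> outer. w \<in> a} + card {b \<in> pieces \<sigma>. f w \<in> b} = 2"
proof (cases "\<exists>x\<in>X. f w \<in> nbhd x")
  case True
  then obtain x where x: "x \<in> X" "f w \<in> nbhd x" by blast
  obtain v where v: "v \<in> ports" "f w = h x v"
    using vertices_disk[OF x(1)] w x(2) unfolding port_set_def by blast
  obtain k where k: "\<And>k'. v \<in> chord (\<sigma> x) k' \<longleftrightarrow> k' = k" using port_in_unique_chord[OF v(1)] by metis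
  have mem: "f w \<in> piece \<sigma> x k' \<longleftrightarrow> k' = k" for k'
    unfolding piece_def v(2) k[symmetric]
    using inj_on_image_mem_iff[OF disk(3)[OF x(1)] _ chord_subset] v(1) ports_cball by blast
  have "{b \<in> pieces \<sigma>. f w \<in> b} = {piece \<sigma> x k}"
  proof -
    have "b = piece \<sigma> x k" if b: "b \<in> pieces \<sigma>" "f w \<in> b" for b
    proof -
      obtain y k' where y: "y \<in> X" "b = piece \<sigma> y k'" using b(1) unfolding pieces_def by blast
      have "f w \<in> nbhd y" using piece_disk[of \<sigma> y k'] b(2) y(2) by blast
      then have "y = x" using disk_unique[OF y(1) x(1) _ x(2)] by simp
      then show ?thesis using mem[of k'] y b(2) by simp
    qed
    then show ?thesis using mem x(1) unfolding pieces_def by blast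
  qed
  moreover obtain e where "{a \<in> outer. w \<in> a} = {e}" using outer_at_port[OF w x] by blast
  ultimately show ?thesis by simp
next
  case False
  then have "{b \<in> pieces \<sigma>. f w \<in> b} = {}" unfolding pieces_def using piece_disk by blast
  moreover have "card {a \<in> outer. w \<in> a} = 2"
    using False outer_off_disks[of w] arc_systemD(4)[OF system w] by simp
  ultimately show ?thesis by (metis add_0_right card.empty)
qed

text \<open>At each port the lifted strand is replaced by exactly one chord, whichever smoothing is
  chosen. Degree two therefore persists for every \<open>\<sigma>\<close>, and the smoothed diagram
  is always a union of disjoint loops.\<close>

lemma planar_system: "arc_system (f ` V) (edges \<union> pieces \<sigma>)"
  unfolding arc_system_def
proof (intro conjI ballI impI)
  note sys = arc_systemD[OF system]
  have outerB: "outer \<subseteq> \<B>" unfolding outer_def by blast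
  have cont: "continuous_on (source D) f" using link unfolding link_diagram_def by blast
  have f_Int: "f ` a \<inter> f ` b = f ` (a \<inter> b)"
    if "a \<in> insert V outer" "b \<in> insert V outer" for a b
    using that by (intro inj_on_image_Int[OF inj_outer, symmetric]) auto
  have "pieces \<sigma> = (\<lambda>(x, k). piece \<sigma> x k) ` (X \<times> UNIV)" unfolding pieces_def by auto
  then have fin_pieces: "finite (pieces \<sigma>)" using link unfolding link_diagram_def by simp
  have fin_outer: "finite outer" using sys(1) outerB by (rule finite_subset[rotated])
  then show "finite (edges \<union> pieces \<sigma>)" unfolding edges_def using fin_pieces by simp
  show "\<exists>u v. arc_between b u v \<and> b \<inter> f ` V = {u, v}" if b: "b \<in> edges \<union> pieces \<sigma>" for b
    using b
  proof
    assume "b \<in> edges"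
    then obtain a where a: "a \<in> outer" "b = f ` a" unfolding edges_def by blast
    obtain u v where uv: "arc_between a u v" "a \<inter> V = {u, v}" using sys(2) a(1) outerB by blast
    have "a \<subseteq> source D" using a(1) outerB cover by blast
    then have "arc_between b (f u) (f v)"
      unfolding a(2) using a(1)
      by (intro arc_between_continuous_image[OF uv(1)] continuous_on_subset[OF cont] inj_on_subset[OF inj_outer]) auto
    moreover have "b \<inter> f ` V = {f u, f v}" using f_Int[of a V] a uv(2) by auto
    ultimately show ?thesis by blast
  next
    assume "b \<in> pieces \<sigma>"
    then obtain x k where "x \<in> X" "b = piece \<sigma> x k" unfolding pieces_def by blast
    then show ?thesis using piece_arc[of x \<sigma> k] by metis
  qed
  show "b \<inter> c \<subseteq> f ` V" if bc: "b \<in> edges \<union> pieces \<sigma>" "c \<in> edges \<union> pieces \<sigma>" "b \<noteq> c" for b c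
  proof -
    have mixed: "b \<inter> c \<subseteq> f ` V" if bc: "b \<in> edges" "c \<in> pieces \<sigma>" for b c
    proof -
      obtain x k where "x \<in> X" "c = piece \<sigma> x k" using bc(2) unfolding pieces_def by blast
      then show ?thesis using edges_disk(1)[OF bc(1)] piece_disk by blast
    qed
    consider "b \<in> edges" "c \<in> edges" | "b \<in> edges" "c \<in> pieces \<sigma>" | "c \<in> edges" "b \<in> pieces \<sigma>" | "b \<in> pieces \<sigma>" "c \<in> pieces \<sigma>"
      using bc by blast
    then show ?thesis
    proof cases
      case 1
      then obtain a a' where a: "a \<in> outer" "b = f ` a" "a' \<in> outer" "c = f ` a'" unfolding edges_def by blast
      then have "b \<inter> c = f ` (a \<inter> a')" using f_Int by auto
      moreover have "a \<inter> a' \<subseteq> V" using a bc(3) outerB by (intro sys(3)) auto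
      ultimately show ?thesis by blast
    next
      case 2
      then show ?thesis by (rule mixed)
    next
      case 3
      then show ?thesis using mixed by blast
    next
      case 4
      then obtain x k y l where xy: "x \<in> X" "b = piece \<sigma> x k" "y \<in> X" "c = piece \<sigma> y l"
        unfolding pieces_def by blast
      then have "(x, k) \<noteq> (y, l)" using bc(3) by blast
      then show ?thesis using pieces_disjoint[OF xy(1,3)] xy(2,4) by simp
    qed
  qed
  show "card {b \<in> edges \<union> pieces \<sigma>. v \<in> b} = 2" if v: "v \<in> f ` V" for v
  proof -
    obtain w where w: "w \<in> V" "v = f w" using v by blast
    have mem: "f w \<in> f ` a \<longleftrightarrow> w \<in> a" if "a \<in> outer" for a
      using that w(1) by (intro inj_on_image_mem_iff[OF inj_outer]) auto
    then have "{b \<in> edges. v \<in> b} = (`) f ` {a \<in> outer. w \<in> a}" using w(2) unfolding edges_def by auto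
    moreover have "inj_on ((`) f) {a \<in> outer. w \<in> a}"
      by (rule inj_on_image) (use inj_outer in \<open>auto intro: inj_on_subset\<close>)
    ultimately have "card {b \<in> edges. v \<in> b} = card {a \<in> outer. w \<in> a}" by (simp add: card_image)
    moreover have "card ({b \<in> edges. v \<in> b} \<union> {b \<in> pieces \<sigma>. v \<in> b}) = card {b \<in> edges. v \<in> b} + card {b \<in> pieces \<sigma>. v \<in> b}"
    proof (rule card_Un_disjoint)
      show "finite {b \<in> edges. v \<in> b}" using fin_outer unfolding edges_def by simp
      show "finite {b \<in> pieces \<sigma>. v \<in> b}" using fin_pieces by simp
      show "{b \<in> edges. v \<in> b} \<inter> {b \<in> pieces \<sigma>. v \<in> b} = {}"
        using edges_projection piece_not_projection unfolding pieces_def by blast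
    qed
    moreover have "{b \<in> edges \<union> pieces \<sigma>. v \<in> b} = {b \<in> edges. v \<in> b} \<union> {b \<in> pieces \<sigma>. v \<in> b}" by blast
    ultimately show ?thesis using card_pieces_at[OF w(1), of \<sigma>] w(2) by simp
  qed
qed

lemma new_arcs_pieces: "h x ` new_arcs (\<sigma> x) = (\<Union>k. piece \<sigma> x k)"
  unfolding new_arcs_eq piece_def by blast

lemma ports_new_arcs: "port_set x \<subseteq> (\<Union>k. piece \<sigma> x k)"
proof -
  have "ports \<subseteq> (\<Union>k. chord b k)" for b using port_in_unique_chord by blast
  then show ?thesis unfolding piece_def port_set_def image_UN[symmetric] by (rule image_mono)
qed

lemma Union_pieces: "\<Union>(pieces \<sigma>) = (\<Union>x\<in>X. h x ` new_arcs (\<sigma> x))"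
  unfolding new_arcs_pieces pieces_def by blast

lemma projection_eq: "projection D = \<Union>edges \<union> (\<Union>x\<in>X. cross x)"
proof
  show "projection D \<subseteq> \<Union>edges \<union> (\<Union>x\<in>X. cross x)"
  proof
    fix y assume y: "y \<in> projection D"
    then obtain z where z: "z \<in> source D" "y = f z" unfolding projection_def by blast
    then obtain a where a: "a \<in> \<B>" "z \<in> a" using cover by blast
    show "y \<in> \<Union>edges \<union> (\<Union>x\<in>X. cross x)"
    proof (cases "a \<in> outer")
      case True
      then show ?thesis using a z unfolding edges_def by blast
    next
      case False
      then obtain x where "x \<in> X" "y \<in> nbhd x" using a z unfolding outer_def by blast
      then show ?thesis using disk(5) y by blast
    qed
  qed
  show "\<Union>edges \<union> (\<Union>x\<in>X. cross x) \<subseteq> projection D"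
    using edges_projection disk(5) by blast
qed

text \<open>\<open>smoothed_curves\<close> removes the closed strands, and with them the ends of
  edges at the ports; the chords put these points back.\<close>

lemma smoothed_curves_eq: "smoothed_curves D h \<sigma> = \<Union>(edges \<union> pieces \<sigma>)"
proof -
  have "y \<in> \<Union>(pieces \<sigma>)" if "e \<in> edges" "y \<in> e" "x \<in> X" "y \<in> cross x" for e x y
  proof -
    have "y \<in> port_set x"
      using that cross_nbhd by (intro edges_disk(2)[OF that(1,2,3)]) blast
    then show ?thesis using ports_new_arcs[of x \<sigma>] that(3) unfolding pieces_def by blast
  qed
  then show ?thesis
    unfolding smoothed_curves_def cross_def[symmetric] projection_eq Union_Un_distrib Union_pieces[symmetric] by blast
qed

text \<open>Inside a disk the result is the model picture, so where a placed segment meets the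
  curves can be read off in the unit disk.\<close>

lemma smoothed_curves_disk:
  assumes "x \<in> X"
  shows "smoothed_curves D h \<sigma> \<inter> nbhd x = h x ` new_arcs (\<sigma> x)"
proof -
  have new: "h z ` new_arcs (\<sigma> z) \<subseteq> nbhd z" for z
    unfolding new_arcs_pieces using piece_disk by blast
  have "y \<in> h x ` new_arcs (\<sigma> x)" if y: "y \<in> smoothed_curves D h \<sigma>" "y \<in> nbhd x" for y
  proof -
    have "y \<notin> projection D - (\<Union>x\<in>X. cross x)"
      using disk(5)[OF assms] y(2) assms by blast
    then obtain z where z: "z \<in> X" "y \<in> h z ` new_arcs (\<sigma> z)"
      using y(1) unfolding smoothed_curves_def cross_def[symmetric] by blast
    then have "z = x" using disk_unique[OF z(1) assms _ y(2)] new by blast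
    then show ?thesis using z by simp
  qed
  moreover have "h x ` new_arcs (\<sigma> x) \<subseteq> smoothed_curves D h \<sigma> \<inter> nbhd x"
    using assms new unfolding smoothed_curves_def by blast
  ultimately show ?thesis by blast
qed


subsection \<open>Maximal components\<close>

abbreviation component :: "(plane \<Rightarrow> bool) \<Rightarrow> plane \<Rightarrow> plane set" where
  "component \<sigma> p \<equiv> connected_component_set (smoothed_curves D h \<sigma>) p"

lemma member_connected:
  assumes "b \<in> edges \<union> pieces \<sigma>"
  shows "connected b"
  using arc_systemD(2)[OF planar_system assms] arc_between_connected by blast

lemma member_closed:
  assumes "b \<in> edges \<union> pieces \<sigma>"
  shows "closed b"
  using arc_systemD(2)[OF planar_system assms] arc_between_compact compact_imp_closed by blast

text \<open>Members are connected, so a component is a union of members and can be described by the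
  ones it contains.\<close>

lemma member_component:
  assumes "b \<in> edges \<union> pieces \<sigma>"
  shows "b \<subseteq> component \<sigma> p \<or> b \<inter> component \<sigma> p = {}"
proof (cases "b \<inter> component \<sigma> p = {}")
  case False
  then obtain y where y: "y \<in> b" "y \<in> component \<sigma> p" by blast
  have "b \<subseteq> component \<sigma> y"
    using y(1) member_connected[OF assms] assms
    by (intro connected_component_maximal) (auto simp: smoothed_curves_eq)
  also have "component \<sigma> y = component \<sigma> p" using y(2) by (metis connected_component_eq)
  finally show ?thesis by blast
qed simp

text \<open>
  The old component, opened at the removed chord, is still connected, and the new chord attaches
  to it an edge on the other side of the crossing.
\<close>

lemma flip_enlarges:
  assumes x: "x \<in> X" and k: "piece \<sigma> x k \<subseteq> component \<sigma> p" "piece \<sigma> x (\<not> k) \<inter> component \<sigma> p = {}"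
    and p: "e0 \<in> edges" "p \<in> e0"
  shows "{e \<in> edges. e \<subseteq> component \<sigma> p} \<subset> {e \<in> edges. e \<subseteq> component (\<sigma>(x := \<not> \<sigma> x)) p}"
proof -
  let ?K = "component \<sigma> p" and ?\<tau> = "\<sigma>(x := \<not> \<sigma> x)"
  \<comment> \<open>The new chord \<open>k'\<close> leads from the end \<open>u\<close> of the
    removed chord \<open>k\<close> to an end \<open>v\<close> of the chord outside the
    component.\<close>
  obtain k' u v where uv: "u \<in> ports" "v \<in> ports" "u \<in> chord (\<sigma> x) k" "v \<notin> chord (\<sigma> x) k"
    "u \<in> chord (\<not> \<sigma> x) k'" "v \<in> chord (\<not> \<sigma> x) k'"
    using chord_flip[of "\<sigma> x" k] by metis
  obtain a b where ab: "arc_between (piece \<sigma> x k) a b" "piece \<sigma> x k \<inter> f ` V = {a, b}"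
    using piece_arc[OF x] by metis
  have pU: "p \<in> \<Union>(edges \<union> pieces \<sigma>)" using p by blast
  have "loop_image ?K"
    unfolding smoothed_curves_eq by (rule arc_system_component[OF planar_system pU])
  then obtain d where d: "arc_between d a b" "piece \<sigma> x k \<union> d = ?K" "piece \<sigma> x k \<inter> d = {a, b}"
    using loop_image_remove_arc[OF _ ab(1) k(1)] by metis
  have "h x u \<in> piece \<sigma> x k \<inter> f ` V"
    unfolding piece_vertices[OF x] using uv(1,3) by blast
  then have ud: "h x u \<in> d" using ab(2) d(3) by blast
  have "v \<in> chord (\<sigma> x) (\<not> k)" using port_in_unique_chord[OF uv(2), of "\<sigma> x"] uv(4) by (metis (full_types))
  then have vK: "h x v \<notin> ?K" using k(2) unfolding piece_def by blast
  have "h x v \<in> port_set x" unfolding port_set_def using uv(2) by (rule imageI)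
  then have "h x v \<in> f ` V" using vertices_disk[OF x] by auto
  then obtain w where w: "w \<in> V" "f w = h x v" by auto
  \<comment> \<open>The edge leaving the disk at \<open>v\<close> is the one gained: its point
    \<open>h x v\<close> lies on a chord disjoint from the old component.\<close>
  obtain c where c: "c \<in> outer" "w \<in> c" using outer_at_vertex[OF w(1)] .
  define e1 where "e1 = f ` c"
  have e1: "e1 \<in> edges" "h x v \<in> e1" using c w(2) unfolding e1_def edges_def by (auto simp flip: w(2))
  let ?s = "piece ?\<tau> x k'"
  have s: "?s \<in> pieces ?\<tau>" "h x u \<in> ?s" "h x v \<in> ?s"
    using x uv(5,6) unfolding pieces_def piece_def by auto
  let ?N = "d \<union> ?s \<union> e1"
  have "connected ?N"
  proof (intro connected_Un)
    show "connected d" using d(1) by (rule arc_between_connected)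
    show "connected ?s" "connected e1" using member_connected[of _ ?\<tau>] s(1) e1(1) by blast+
    show "d \<inter> ?s \<noteq> {}" using ud s(2) by blast
    show "(d \<union> ?s) \<inter> e1 \<noteq> {}" using s(3) e1(2) by blast
  qed
  moreover have "?N \<subseteq> smoothed_curves D h ?\<tau>"
  proof -
    have "y \<in> \<Union>(edges \<union> pieces ?\<tau>)" if y: "y \<in> d" for y
    proof -
      have "y \<in> \<Union>(edges \<union> pieces \<sigma>)"
        using y d(2) connected_component_subset unfolding smoothed_curves_eq[symmetric] by blast
      then consider "y \<in> \<Union>edges" | z l where "z \<in> X" "y \<in> piece \<sigma> z l" unfolding pieces_def by blast
      then show ?thesis
      proof cases
        case 1
        then show ?thesis by blast
      next
        case 2
        show ?thesis
        proof (cases "z = x")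
          case True
          \<comment> \<open>Of the two chords removed at \<open>x\<close>, one misses the component
            and the other meets \<open>d\<close> only in its ends. These ends are ports, which the
            new chords cover as well.\<close>
          have "y \<notin> piece \<sigma> x (\<not> k)" using y d(2) k(2) by blast
          then have "l = k" using 2(2) True by (cases l; cases k) auto
          then have "y \<in> f ` V \<inter> nbhd x"
            using 2(2) True y d(3) ab(2) piece_disk by blast
          then have "y \<in> (\<Union>l. piece ?\<tau> x l)" using vertices_disk[OF x] ports_new_arcs by blast
          then show ?thesis using x unfolding pieces_def by blast
        next
          case False
          then have "y \<in> piece ?\<tau> z l" using 2(2) unfolding piece_def by simp
          then show ?thesis using 2(1) unfolding pieces_def by blast
        qed
      qed
    qed
    then show ?thesis unfolding smoothed_curves_eq using s(1) e1(1) by blast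
  qed
  moreover have old: "e \<subseteq> d" if e: "e \<in> edges" "e \<subseteq> ?K" for e
  proof -
    \<comment> \<open>Being distinct members, \<open>e\<close> and the removed chord meet only in
      vertices, that is, in the ends of the chord, and those belong to \<open>d\<close>.\<close>
    have "e \<noteq> piece \<sigma> x k" using edges_projection[OF e(1)] piece_not_projection[OF x] by blast
    then have "e \<inter> piece \<sigma> x k \<subseteq> f ` V"
      using arc_systemD(3)[OF planar_system[of \<sigma>], of e "piece \<sigma> x k"] e(1) x unfolding pieces_def by blast
    then show ?thesis using e(2) d(2,3) ab(2) by blast
  qed
  moreover have "p \<in> ?N"
  proof -
    have "p \<in> ?K" using pU by (simp add: smoothed_curves_eq connected_component_refl_eq)
    then have "e0 \<subseteq> ?K" using member_component[of e0 \<sigma> p] p by blast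
    then show ?thesis using old[OF p(1)] p(2) by blast
  qed
  ultimately have "?N \<subseteq> component ?\<tau> p" by (intro connected_component_maximal)
  then have "{e \<in> edges. e \<subseteq> ?K} \<subseteq> {e \<in> edges. e \<subseteq> component ?\<tau> p}" "e1 \<subseteq> component ?\<tau> p"
    using old by blast+
  moreover have "\<not> e1 \<subseteq> ?K" using e1(2) vK by blast
  ultimately show ?thesis using e1(1) by blast
qed

text \<open>By \<open>same\<close> every crossing belongs as a whole to the component or to its
  complement. This divides the unsmoothed projection into two disjoint closed sets, and
  connectedness empties the one without \<open>p\<close>.\<close>

lemma one_component:
  assumes conn: "connected_diagram D" and p: "e0 \<in> edges" "p \<in> e0"
    and same: "\<And>x k. x \<in> X \<Longrightarrow> piece \<sigma> x k \<subseteq> component \<sigma> p \<Longrightarrow> piece \<sigma> x (\<not> k) \<subseteq> component \<sigma> p"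
  shows "component \<sigma> p = smoothed_curves D h \<sigma>"
proof
  let ?K = "component \<sigma> p"
  show "?K \<subseteq> smoothed_curves D h \<sigma>" by (rule connected_component_subset)
  \<comment> \<open>Either chord in the component brings the other with it, so testing the chord
    \<open>True\<close> decides for both.\<close>
  define X1 where "X1 = {x \<in> X. piece \<sigma> x True \<subseteq> ?K}"
  have X1: "piece \<sigma> x k \<subseteq> ?K" if "x \<in> X1" for x k
    using that same[of x True] unfolding X1_def by (cases k) auto
  have X2: "piece \<sigma> x k \<inter> ?K = {}" if "x \<in> X - X1" for x k
    using that same[of x False] member_component[of "piece \<sigma> x k" \<sigma> p]
    unfolding X1_def pieces_def by (cases k) auto
  define P1 where "P1 = \<Union>{e \<in> edges. e \<subseteq> ?K} \<union> (\<Union>x\<in>X1. cross x)"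
  define P2 where "P2 = \<Union>{e \<in> edges. e \<inter> ?K = {}} \<union> (\<Union>x\<in>X-X1. cross x)"
  have finX: "finite X" using link unfolding link_diagram_def by blast
  have fin_edges: "finite edges" using arc_systemD(1)[OF planar_system] by blast
  have closed_cross: "closed (cross x)" if "x \<in> X" for x
    unfolding cross_def using disk(2)[OF that] strand_subset
    by (intro compact_imp_closed compact_continuous_image)
      (auto simp: strand_def intro: continuous_on_subset)
  have closed_edges: "closed e" if "e \<in> edges" for e using that member_closed by blast
  have closed1: "closed P1" unfolding P1_def
    using finX fin_edges closed_cross closed_edges by (intro closed_Un closed_Union closed_UN) (auto simp: X1_def)
  have closed2: "closed P2" unfolding P2_def
    using finX fin_edges closed_cross closed_edges by (intro closed_Un closed_Union closed_UN) auto
  \<comment> \<open>An edge meets a cross only in ports, and each port lies on a chord. Hence an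
    edge and a cross that touch are on the same side of the partition.\<close>
  have edges_cross: "y \<in> (\<Union>k. piece \<sigma> x k)" if "e \<in> edges" "y \<in> e" "x \<in> X" "y \<in> cross x" for e x y
    using edges_disk(2)[OF that(1-3)] that(4) cross_nbhd ports_new_arcs by blast
  have disjoint: "P1 \<inter> P2 = {}"
  proof -
    have False if y: "y \<in> P1" "y \<in> P2" for y
    proof -
      consider e where "e \<in> edges" "e \<subseteq> ?K" "y \<in> e" | x where "x \<in> X1" "y \<in> cross x"
        using y(1) unfolding P1_def by blast
      then show False
      proof cases
        case 1
        then have yK: "y \<in> ?K" by blast
        consider e where "e \<in> edges" "e \<inter> ?K = {}" "y \<in> e" | x' where "x' \<in> X - X1" "y \<in> cross x'"
          using y(2) unfolding P2_def by blast
        then show False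
        proof cases
          case 1
          then show ?thesis using yK by blast
        next
          case 2
          then show ?thesis using edges_cross[OF 1(1,3)] X2 yK by blast
        qed
      next
        case 2
        then have x: "x \<in> X" by (simp add: X1_def)
        consider e where "e \<in> edges" "e \<inter> ?K = {}" "y \<in> e" | x' where "x' \<in> X - X1" "y \<in> cross x'"
          using y(2) unfolding P2_def by blast
        then show False
        proof cases
          case 1
          then show ?thesis using edges_cross[OF 1(1,3) x 2(2)] X1[OF 2(1)] by blast
        next
          case c2: 2
          then have "x = x'"
            using disk_unique[OF x, of x' y] 2(2) cross_nbhd[of x] cross_nbhd[of x'] by auto
          then show ?thesis using 2(1) c2(1) by simp
        qed
      qed
    qed
    then show ?thesis by blast
  qed
  have "projection D \<subseteq> P1 \<union> P2"
    unfolding projection_eq P1_def P2_def using member_component[of _ \<sigma> p] by blast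
  moreover have "p \<in> P1 \<inter> projection D"
  proof -
    have "p \<in> ?K" using p by (auto simp: smoothed_curves_eq connected_component_refl_eq)
    then have "e0 \<subseteq> ?K" using member_component[of e0 \<sigma> p] p by blast
    then show ?thesis using p edges_projection unfolding P1_def by blast
  qed
  moreover have "connected (projection D)" using conn unfolding connected_diagram_def .
  ultimately have "P2 \<inter> projection D = {}"
    using connected_closedD[of "projection D" P1 P2] disjoint closed1 closed2 by blast
  then have P2: "P2 = {}" unfolding projection_eq P2_def by blast
  have "e \<subseteq> ?K" if e: "e \<in> edges" for e
  proof (rule ccontr)
    assume "\<not> e \<subseteq> ?K"
    then have "e \<subseteq> P2" using e member_component[of e \<sigma> p] unfolding P2_def by blast
    then show False using P2 \<open>\<not> e \<subseteq> ?K\<close> by blast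
  qed
  moreover have "X \<subseteq> X1"
  proof
    fix x assume x: "x \<in> X"
    have "0 \<in> strand 1 \<union> strand 2" by (simp add: mem_strand)
    then have "h x 0 \<in> cross x" unfolding cross_def by (rule imageI)
    then have "x \<in> cross x" using disk(4)[OF x] by simp
    then show "x \<in> X1" using P2 x unfolding P2_def by blast
  qed
  then have "b \<subseteq> ?K" if "b \<in> pieces \<sigma>" for b
    using that X1 unfolding pieces_def by blast
  ultimately have "\<Union>(edges \<union> pieces \<sigma>) \<subseteq> ?K" by blast
  then show "smoothed_curves D h \<sigma> \<subseteq> ?K" by (simp only: smoothed_curves_eq)
qed

lemma loop_smoothing_exists:
  assumes conn: "connected_diagram D"
  shows "\<exists>\<sigma>. loop_image (smoothed_curves D h \<sigma>)"
proof -
  have "(0, 1) \<in> source D" using link unfolding link_diagram_def source_def by auto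
  then obtain a where a: "a \<in> \<B>" using cover by blast
  then obtain z where "z \<in> V" using arc_systemD(2)[OF system] by blast
  then obtain c where c: "c \<in> outer" "z \<in> c" by (rule outer_at_vertex)
  \<comment> \<open>The base point lies on an outer edge, so it belongs to the smoothed curves for
    every \<open>\<sigma>\<close>.\<close>
  define p where "p = f z"
  have p: "f ` c \<in> edges" "p \<in> f ` c" using c unfolding edges_def p_def by auto
  have fin_edges: "finite edges" using arc_systemD(1)[OF planar_system] by blast
  define m where "m \<sigma> = card {e \<in> edges. e \<subseteq> component \<sigma> p}" for \<sigma>
  \<comment> \<open>There are infinitely many functions \<open>\<sigma>\<close>, but the bound
    \<open>card edges\<close> is uniform, so the maximum is attained.\<close>
  have "m \<sigma> \<le> card edges" for \<sigma> unfolding m_def using fin_edges by (intro card_mono) auto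
  then obtain \<sigma> where \<sigma>: "\<And>\<tau>. m \<tau> \<le> m \<sigma>"
    using ex_has_greatest_nat[of "\<lambda>_. True" undefined m "Suc (card edges)"]
    by (auto simp: less_Suc_eq_le)
  have "component \<sigma> p = smoothed_curves D h \<sigma>"
  proof (rule one_component[OF conn p])
    fix x k assume x: "x \<in> X" and k: "piece \<sigma> x k \<subseteq> component \<sigma> p"
    show "piece \<sigma> x (\<not> k) \<subseteq> component \<sigma> p"
    proof (rule ccontr)
      assume "\<not> piece \<sigma> x (\<not> k) \<subseteq> component \<sigma> p"
      then have "piece \<sigma> x (\<not> k) \<inter> component \<sigma> p = {}"
        using member_component[of "piece \<sigma> x (\<not> k)" \<sigma> p] x unfolding pieces_def by blast
      then have "m \<sigma> < m (\<sigma>(x := \<not> \<sigma> x))"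
        unfolding m_def using fin_edges by (intro psubset_card_mono flip_enlarges[OF x k _ p]) auto
      then show False using \<sigma> by (simp add: not_less[symmetric])
    qed
  qed
  moreover have "p \<in> \<Union>(edges \<union> pieces \<sigma>)" using p by blast
  then have "loop_image (component \<sigma> p)"
    unfolding smoothed_curves_eq by (rule arc_system_component[OF planar_system])
  ultimately show ?thesis by metis
qed

end

section \<open>Existence of the cut and assembly of the system\<close>

lemma cut_diagram_exists:
  assumes link: "link_diagram D"
  obtains h V \<B> where "cut_diagram D h V \<B>"
proof -
  have finX: "finite (crossings D)" and fin_pre: "\<And>x. finite (preimages D x)"
    using link unfolding link_diagram_def by auto
  \<comment> \<open>The order of choices matters: auxiliary vertices off the crossings, then disks
    avoiding the images of these vertices, and finally the ports, which depend on the disks.\<close>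
  obtain W \<A> where W: "arc_system W \<A>" "\<Union>\<A> = source D" "W \<subseteq> source D" "finite W"
    "W \<inter> (\<Union>x\<in>crossings D. preimages D x) = {}"
    using source_arc_system[of "\<Union>x\<in>crossings D. preimages D x" D] finX fin_pre by blast
  have "param D ` W \<inter> crossings D = {}"
    using W(3,5) unfolding preimages_def by blast
  then obtain h where h: "smoothing_disks D h"
    "\<And>x. x \<in> crossings D \<Longrightarrow> h x ` cball 0 1 \<inter> param D ` W = {}"
    using smoothing_disks_exist[OF link, of "param D ` W"] W(4) by blast
  \<comment> \<open>All preimages of ports, a finite set; subdividing at these points establishes
    the condition on vertices over the disks.\<close>
  define F where "F = (\<Union>x\<in>crossings D. \<Union>y\<in>h x ` ports. preimages D y)"
  have "finite F" unfolding F_def using finX fin_pre by (auto simp: ports_def)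
  moreover have F: "F \<subseteq> source D" unfolding F_def preimages_def by blast
  ultimately obtain \<B> where B: "arc_system (W \<union> F) \<B>" "\<Union>\<B> = source D"
    using arc_system_refine[OF _ W(1), of F] W(2) by auto
  have "cut_diagram D h (W \<union> F) \<B>"
  proof
    fix x z assume x: "x \<in> crossings D" "z \<in> source D" "param D z \<in> h x ` cball 0 1"
    have "z \<notin> W" using h(2)[OF x(1)] x(3) by blast
    moreover have "z \<in> F \<longleftrightarrow> param D z \<in> h x ` ports"
    proof
      assume "z \<in> F"
      then obtain y where y: "y \<in> crossings D" "param D z \<in> h y ` ports"
        unfolding F_def preimages_def by blast
      then have "param D z \<in> h y ` cball 0 1" using ports_subset strand_subset by blast
      then have "y = x"
        using h(1) x(1,3) y(1) unfolding smoothing_disks_def pairwise_def disjnt_def by blast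
      then show "param D z \<in> h x ` ports" using y(2) by simp
    next
      assume "param D z \<in> h x ` ports"
      then show "z \<in> F" using x(1,2) unfolding F_def preimages_def by blast
    qed
    ultimately show "z \<in> W \<union> F \<longleftrightarrow> param D z \<in> h x ` ports" by blast
  qed (use link h(1) B W(3) F in auto)
  then show ?thesis by (rule that)
qed

text \<open>\<open>arc_endpoints\<close> ranges over all parametrisations of the set, so uniqueness
  of the ends has to come from topology, by \<open>arc_between_unique\<close>.\<close>

lemma arc_endpoints_eq:
  assumes "arc_between S u v"
  shows "arc_endpoints S = {u, v}"
proof -
  have mem: "w \<in> arc_endpoints S" if "arc_between S w w'" for w w'
    using that unfolding arc_endpoints_def arc_between_def by blast
  have "w \<in> {u, v}" if w: "w \<in> arc_endpoints S" for w
  proof -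
    obtain g where "arc g" "path_image g = S" "pathstart g = w"
      using w unfolding arc_endpoints_def by blast
    then have "arc_between S w (pathfinish g)" unfolding arc_between_def by blast
    then show ?thesis by (rule arc_between_unique[OF assms])
  qed
  then show ?thesis using mem[OF assms] mem[OF arc_between_sym[OF assms]] by blast
qed

theorem lemma2p1:
  fixes D :: diagram
  assumes "link_diagram D" and "connected_diagram D"
  shows "\<exists>h \<sigma>. smoothing_disks D h \<and>
               monadic_system (smoothed_curves D h \<sigma>) (placed_segments D h \<sigma>)"
proof -
  obtain h V \<B> where "cut_diagram D h V \<B>" using cut_diagram_exists[OF assms(1)] .
  then interpret cut_diagram D h V \<B> .
  obtain \<sigma> where \<sigma>: "loop_image (smoothed_curves D h \<sigma>)"
    using loop_smoothing_exists[OF assms(2)] by blast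
  let ?C = "smoothed_curves D h \<sigma>" and ?seg = "\<lambda>x. h x ` connecting_segment (\<sigma> x)"
  have circle: "is_circle ?C"
    using \<sigma> homeomorphic_simple_path_image_circle[where a = 0 and r = 1]
    unfolding loop_image_def is_circle_def by (metis zero_less_one)
  have seg_disk: "?seg x \<subseteq> nbhd x" for x by (rule image_nbhd[OF connecting_segment_subset])
  have ends: "\<exists>u v. arc_between (?seg x) u v \<and> ?seg x \<inter> ?C = {u, v}" if x: "x \<in> X" for x
  proof -
    obtain u v where uv: "arc_between (connecting_segment (\<sigma> x)) u v"
      "connecting_segment (\<sigma> x) \<inter> new_arcs (\<sigma> x) = {u, v}"
      using connecting_segment_ends by metis
    \<comment> \<open>Within the disk the curves are just the two chords, so the segment touches
      them only at its own ends, the midpoints of the chords.\<close>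
    have "new_arcs (\<sigma> x) \<subseteq> cball 0 1" unfolding new_arcs_eq using chord_subset by blast
    then have "?seg x \<inter> h x ` new_arcs (\<sigma> x) = {h x u, h x v}"
      using disk_Int[OF x connecting_segment_subset] uv(2) by simp
    then have "?seg x \<inter> ?C = {h x u, h x v}"
      using smoothed_curves_disk[OF x, of \<sigma>] seg_disk by blast
    moreover have "arc_between (?seg x) (h x u) (h x v)"
      using disk(2,3)[OF x] connecting_segment_subset
      by (intro arc_between_continuous_image[OF uv(1)]) (auto intro: continuous_on_subset inj_on_subset)
    ultimately show ?thesis by blast
  qed
  have endpoints: "?seg x \<inter> ?C = arc_endpoints (?seg x)" if "x \<in> X" for x
    using ends[OF that] arc_endpoints_eq by metis
  have "circles_arcs_system ?C (placed_segments D h \<sigma>)"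
    unfolding circles_arcs_system_def
  proof (intro exI conjI)
    \<comment> \<open>The whole curve part is a single circle, so the family of circles is a
      singleton.\<close>
    show "finite {?C}" "pairwise disjnt {?C}" "\<forall>c\<in>{?C}. is_circle c" "?C = \<Union>{?C}"
      using circle by auto
    show "finite (?seg ` X)" using link unfolding link_diagram_def by simp
    show "placed_segments D h \<sigma> = \<Union>(?seg ` X)" unfolding placed_segments_def ..
    show "\<forall>a\<in>?seg ` X. is_arc a" using ends unfolding is_arc_def arc_between_def by blast
    show "pairwise disjnt (?seg ` X)"
    proof (rule pairwise_imageI)
      fix x y assume "x \<in> X" "y \<in> X" "x \<noteq> y"
      then show "disjnt (?seg x) (?seg y)"
        using disk_unique seg_disk unfolding disjnt_def by blast
    qed
    have "placed_segments D h \<sigma> \<inter> ?C = (\<Union>x\<in>X. ?seg x \<inter> ?C)"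
      unfolding placed_segments_def by blast
    also have "\<dots> = (\<Union>x\<in>X. arc_endpoints (?seg x))" by (rule SUP_cong[OF refl endpoints])
    finally show "placed_segments D h \<sigma> \<inter> ?C = (\<Union>a\<in>?seg ` X. arc_endpoints a)" by simp
  qed
  then show ?thesis using disks circle unfolding monadic_system_def by blast
qed

end
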